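(* Let $\mathbf D=\mathbf D(k,\pi_\bullet)$ be a generalized divided power algebra over a noetherian commutative ring $k$. Assume the Jacobson radical of $k$ contains $\pi_n$ for infinitely many $n$. Let $M$ and $N$ be finitely presented graded $\mathbf D$-modules such that $\tau_{\ge n}(M)\cong\tau_{\ge n}(N)$ as graded $\mathbf D$-modules for some $n$. Then $M\cong N$ as graded $\mathbf D$-modules. Consequently, any two weak fp-envelopes of a nearly finitely presented graded $\mathbf D$-module are isomorphic.
   Context: $\pi$-sequences. A $\pi$-sequence in $k$ is a sequence $(\pi_n)_{n\ge2}$ in $k$, with $\pi_1=0$. For integers $j\ge1$ and $n,m\ge0$ put $\epsilon_j(n,m)=\lfloor (n+m)/j\rfloor-\lfloor n/j\rfloor-\lfloor m/j\rfloor$, and $C(n,m)=\prod_{j\ge2}\pi_j^{\epsilon_j(n-m,m)}$. The sequence is admissible if, whenever $(\pi_n,\pi_m)\ne k$, $n\mid m$ or $m\mid n$. GDPAs. $\mathbf D(k,\pi_\bullet)$ is the graded $k$-algebra free on basis $x^{[i]}$ ($\deg x^{[i]}=i$) with $x^{[n-m]}x^{[m]}=C(n,m)x^{[n]}$. A GDPA is such an algebra with $\pi_\bullet$ admissible. Truncation and nfp modules. - $\tau_{\ge n}(M)=\bigoplus_{j\ge n}M_j$. - A graded $\mathbf D$-module $M$ is nearly finitely presented if each $M_j$ is finitely generated over $k$, $M_j=0$ for $j\ll 0$, and there is a finitely presented graded $N$ with $\tau_{\ge n}(M)\cong\tau_{\ge n}(N)$ for some $n$. - Any such $N$ is a weak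 fp-envelope of $M$. *)

theory Defs
  imports Complex_Main
begin

definition is_ideal :: "'k::comm_ring_1 set \<Rightarrow> bool" where
  "is_ideal I \<longleftrightarrow> 0 \<in> I \<and> (\<forall>x\<in>I. \<forall>y\<in>I. x + y \<in> I) \<and> (\<forall>r. \<forall>x\<in>I. r * x \<in> I)"

definition ideal_gen :: "'k::comm_ring_1 set \<Rightarrow> 'k set" where
  "ideal_gen F = {(\<Sum>f\<in>F. c f * f) | c. True}"

definition noetherian :: "'k::comm_ring_1 itself \<Rightarrow> bool" where
  "noetherian _ \<longleftrightarrow>
     (\<forall>I::'k set. is_ideal I \<longrightarrow> (\<exists>F. finite F \<and> F \<subseteq> I \<and> I = ideal_gen F))"

definition maximal_ideal :: "'k::comm_ring_1 set \<Rightarrow> bool" where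
  "maximal_ideal I \<longleftrightarrow> is_ideal I \<and> I \<noteq> UNIV \<and>
     (\<forall>J. is_ideal J \<and> I \<subseteq> J \<longrightarrow> J = I \<or> J = UNIV)"

definition jacobson_radical :: "'k::comm_ring_1 itself \<Rightarrow> 'k set" where
  "jacobson_radical _ = \<Inter>{I::'k set. maximal_ideal I}"

definition pi_sequence :: "(nat \<Rightarrow> 'k::comm_ring_1) \<Rightarrow> bool" where
  "pi_sequence \<pi> \<longleftrightarrow> \<pi> 1 = 0"

definition admissible :: "(nat \<Rightarrow> 'k::comm_ring_1) \<Rightarrow> bool" where
  "admissible \<pi> \<longleftrightarrow>
     (\<forall>n\<ge>1. \<forall>m\<ge>1. \<not> (\<exists>a b. a * \<pi> n + b * \<pi> m = 1) \<longrightarrow> n dvd m \<or> m dvd n)"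

definition eps :: "nat \<Rightarrow> nat \<Rightarrow> nat \<Rightarrow> nat" where
  "eps j n m = (n + m) div j - n div j - m div j"

text \<open>C(n,m) = prod over j>=2 of pi_j^eps_j(n-m,m); factors with j > n are 1.\<close>
definition Cf :: "(nat \<Rightarrow> 'k::comm_ring_1) \<Rightarrow> nat \<Rightarrow> nat \<Rightarrow> 'k" where
  "Cf \<pi> n m = (\<Prod>j\<in>{2..n}. \<pi> j ^ eps j (n - m) m)"

text \<open>A graded D(k,pi)-module is given degreewise: components M j (j :: int), each a
  k-submodule of an ambient k-module (scalar action sc), and for each i the action
  act i j : M_j \<rightarrow> M_(j+i) of the basis element x^[i]. The module is the external
  direct sum of the M j.  Since D is k-free on the x^[i] with
  x^[i] x^[m] = C(i+m,m) x^[i+m], this is exactly a graded D-module structure.\<close>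
definition graded_Dmod ::
  "(nat \<Rightarrow> 'k::comm_ring_1) \<Rightarrow> ('k \<Rightarrow> 'm::ab_group_add \<Rightarrow> 'm) \<Rightarrow> (int \<Rightarrow> 'm set)
     \<Rightarrow> (nat \<Rightarrow> int \<Rightarrow> 'm \<Rightarrow> 'm) \<Rightarrow> bool" where
  "graded_Dmod \<pi> sc M act \<longleftrightarrow>
     module sc \<and> (\<forall>j. module.subspace sc (M j)) \<and>
     (\<forall>i j. \<forall>v\<in>M j. act i j v \<in> M (j + int i)) \<and>
     (\<forall>i j a. \<forall>u\<in>M j. \<forall>v\<in>M j. act i j (sc a u + v) = sc a (act i j u) + act i j v) \<and>
     (\<forall>j. \<forall>v\<in>M j. act 0 j v = v) \<and>
     (\<forall>i m j. \<forall>v\<in>M j. act i (j + int m) (act m j v) = sc (Cf \<pi> (i + m) m) (act (i + m) j v))"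

definition gr_iso ::
  "('k::comm_ring_1 \<Rightarrow> 'm::ab_group_add \<Rightarrow> 'm) \<Rightarrow> (int \<Rightarrow> 'm set) \<Rightarrow> (nat \<Rightarrow> int \<Rightarrow> 'm \<Rightarrow> 'm)
   \<Rightarrow> ('k \<Rightarrow> 'n::ab_group_add \<Rightarrow> 'n) \<Rightarrow> (int \<Rightarrow> 'n set) \<Rightarrow> (nat \<Rightarrow> int \<Rightarrow> 'n \<Rightarrow> 'n)
   \<Rightarrow> (int \<Rightarrow> 'm \<Rightarrow> 'n) \<Rightarrow> bool" where
  "gr_iso sc M act sc' N act' f \<longleftrightarrow>
     (\<forall>j. bij_betw (f j) (M j) (N j)) \<and>
     (\<forall>j a. \<forall>u\<in>M j. \<forall>v\<in>M j. f j (sc a u + v) = sc' a (f j u) + f j v) \<and>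
     (\<forall>i j. \<forall>v\<in>M j. f (j + int i) (act i j v) = act' i j (f j v))"

definition gr_isomorphic ::
  "('k::comm_ring_1 \<Rightarrow> 'm::ab_group_add \<Rightarrow> 'm) \<Rightarrow> (int \<Rightarrow> 'm set) \<Rightarrow> (nat \<Rightarrow> int \<Rightarrow> 'm \<Rightarrow> 'm)
   \<Rightarrow> ('k \<Rightarrow> 'n::ab_group_add \<Rightarrow> 'n) \<Rightarrow> (int \<Rightarrow> 'n set) \<Rightarrow> (nat \<Rightarrow> int \<Rightarrow> 'n \<Rightarrow> 'n) \<Rightarrow> bool" where
  "gr_isomorphic sc M act sc' N act' \<longleftrightarrow> (\<exists>f. gr_iso sc M act sc' N act' f)"

definition trunc :: "int \<Rightarrow> (int \<Rightarrow> 'm::zero set) \<Rightarrow> (int \<Rightarrow> 'm set)" where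
  "trunc n M = (\<lambda>j. if n \<le> j then M j else {0})"

text \<open>Free graded module F = \<Oplus>_{s<r} D(-d s) with basis e_s in degree d s:
  its degree-j part is identified with coefficient vectors c :: nat \<Rightarrow> 'k supported on
  {s. s < r \<and> d s \<le> j}, c standing for \<Sum> c s x^[j - d s] e_s.\<close>
definition free_comp :: "nat \<Rightarrow> (nat \<Rightarrow> int) \<Rightarrow> int \<Rightarrow> (nat \<Rightarrow> 'k::comm_ring_1) set" where
  "free_comp r d j = {c. \<forall>s. \<not> (s < r \<and> d s \<le> j) \<longrightarrow> c s = 0}"

definition free_act ::
  "(nat \<Rightarrow> 'k::comm_ring_1) \<Rightarrow> nat \<Rightarrow> (nat \<Rightarrow> int) \<Rightarrow> nat \<Rightarrow> int \<Rightarrow> (nat \<Rightarrow> 'k) \<Rightarrow> (nat \<Rightarrow> 'k)" where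
  "free_act \<pi> r d i j c =
     (\<lambda>s. if s < r \<and> d s \<le> j then Cf \<pi> (i + nat (j - d s)) (nat (j - d s)) * c s else 0)"

definition pres_map ::
  "('k::comm_ring_1 \<Rightarrow> 'm::ab_group_add \<Rightarrow> 'm) \<Rightarrow> (nat \<Rightarrow> int \<Rightarrow> 'm \<Rightarrow> 'm)
   \<Rightarrow> nat \<Rightarrow> (nat \<Rightarrow> int) \<Rightarrow> (nat \<Rightarrow> 'm) \<Rightarrow> int \<Rightarrow> (nat \<Rightarrow> 'k) \<Rightarrow> 'm" where
  "pres_map sc act r d g j c =
     (\<Sum>s\<in>{s. s < r \<and> d s \<le> j}. sc (c s) (act (nat (j - d s)) (d s) (g s)))"

definition gr_generated_by ::
  "('k::comm_ring_1 \<Rightarrow> 'm::ab_group_add \<Rightarrow> 'm) \<Rightarrow> (int \<Rightarrow> 'm set) \<Rightarrow> (nat \<Rightarrow> int \<Rightarrow> 'm \<Rightarrow> 'm)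
   \<Rightarrow> nat \<Rightarrow> (nat \<Rightarrow> int) \<Rightarrow> (nat \<Rightarrow> 'm) \<Rightarrow> bool" where
  "gr_generated_by sc M act r d g \<longleftrightarrow>
     (\<forall>s<r. g s \<in> M (d s)) \<and>
     (\<forall>j. \<forall>v\<in>M j. \<exists>c\<in>free_comp r d j. v = pres_map sc act r d g j c)"

definition rel_comp ::
  "('k::comm_ring_1 \<Rightarrow> 'm::ab_group_add \<Rightarrow> 'm) \<Rightarrow> (nat \<Rightarrow> int \<Rightarrow> 'm \<Rightarrow> 'm)
   \<Rightarrow> nat \<Rightarrow> (nat \<Rightarrow> int) \<Rightarrow> (nat \<Rightarrow> 'm) \<Rightarrow> int \<Rightarrow> (nat \<Rightarrow> 'k) set" where
  "rel_comp sc act r d g j = {c \<in> free_comp r d j. pres_map sc act r d g j c = 0}"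

definition rel_fin_gen ::
  "(nat \<Rightarrow> 'k::comm_ring_1) \<Rightarrow> ('k \<Rightarrow> 'm::ab_group_add \<Rightarrow> 'm) \<Rightarrow> (nat \<Rightarrow> int \<Rightarrow> 'm \<Rightarrow> 'm)
   \<Rightarrow> nat \<Rightarrow> (nat \<Rightarrow> int) \<Rightarrow> (nat \<Rightarrow> 'm) \<Rightarrow> bool" where
  "rel_fin_gen \<pi> sc act r d g \<longleftrightarrow>
     (\<exists>q e h. (\<forall>t<q. h t \<in> rel_comp sc act r d g (e t)) \<and>
        (\<forall>j. \<forall>c\<in>rel_comp sc act r d g j. \<exists>a::nat \<Rightarrow> 'k. \<forall>s.
            c s = (\<Sum>t\<in>{t. t < q \<and> e t \<le> j}. a t * free_act \<pi> r d (nat (j - e t)) (e t) (h t) s)))"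

definition fin_pres ::
  "(nat \<Rightarrow> 'k::comm_ring_1) \<Rightarrow> ('k \<Rightarrow> 'm::ab_group_add \<Rightarrow> 'm) \<Rightarrow> (int \<Rightarrow> 'm set)
     \<Rightarrow> (nat \<Rightarrow> int \<Rightarrow> 'm \<Rightarrow> 'm) \<Rightarrow> bool" where
  "fin_pres \<pi> sc M act \<longleftrightarrow> graded_Dmod \<pi> sc M act \<and>
     (\<exists>r d g. gr_generated_by sc M act r d g \<and> rel_fin_gen \<pi> sc act r d g)"

definition nfp_conditions ::
  "(nat \<Rightarrow> 'k::comm_ring_1) \<Rightarrow> ('k \<Rightarrow> 'm::ab_group_add \<Rightarrow> 'm) \<Rightarrow> (int \<Rightarrow> 'm set)
     \<Rightarrow> (nat \<Rightarrow> int \<Rightarrow> 'm \<Rightarrow> 'm) \<Rightarrow> bool" where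
  "nfp_conditions \<pi> sc M act \<longleftrightarrow> graded_Dmod \<pi> sc M act \<and>
     (\<forall>j. \<exists>F. finite F \<and> F \<subseteq> M j \<and> module.span sc F = M j) \<and>
     (\<exists>n0. \<forall>j<n0. M j = {0})"

text \<open>N is a weak fp-envelope of the nearly finitely presented module M: M satisfies the
  degreewise conditions, N is finitely presented and tau_{>=n} M \<cong> tau_{>=n} N for some n.
  (N itself witnesses that M is nearly finitely presented.)\<close>
definition weak_fp_envelope ::
  "(nat \<Rightarrow> 'k::comm_ring_1) \<Rightarrow> ('k \<Rightarrow> 'm::ab_group_add \<Rightarrow> 'm) \<Rightarrow> (int \<Rightarrow> 'm set) \<Rightarrow> (nat \<Rightarrow> int \<Rightarrow> 'm \<Rightarrow> 'm)
   \<Rightarrow> ('k \<Rightarrow> 'n::ab_group_add \<Rightarrow> 'n) \<Rightarrow> (int \<Rightarrow> 'n set) \<Rightarrow> (nat \<Rightarrow> int \<Rightarrow> 'n \<Rightarrow> 'n) \<Rightarrow> bool" where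
  "weak_fp_envelope \<pi> sc M act sc' N act' \<longleftrightarrow>
     nfp_conditions \<pi> sc M act \<and> fin_pres \<pi> sc' N act' \<and>
     (\<exists>n. gr_isomorphic sc (trunc n M) act sc' (trunc n N) act')"

end

theory Submission
  imports Defs "HOL-Library.Function_Algebras" "HOL-Library.Infinite_Set"
begin

text \<open>
  The indices \<open>N\<close> with \<open>\<pi>\<^sub>N\<close> in the Jacobson radical \<open>J\<close> form a divisibility chain, and every \<open>\<pi>\<^sub>j\<close>
  with \<open>j\<close> incomparable to such an \<open>N\<close> is a unit. Hence, for \<open>N\<close> far out in the chain and
  \<open>P\<close> the product of many of the earlier \<open>\<pi>\<close>'s, \<open>x\<^sup>[\<^sup>N\<^sup>]\<close> identifies \<open>M\<^sub>j / P\<close> with a quotient of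
  \<open>M\<^sub>j\<^sub>+\<^sub>N\<close>, compatibly with the action of elements of small degree. An isomorphism
  \<open>\<phi>\<close> between truncations need not extend to all of \<open>M\<close> when \<open>k\<close> is not complete, but through
  these identifications it sends the generators of \<open>M\<close> to elements of \<open>N\<close> satisfying
  the relations of \<open>M\<close> modulo \<open>P\<close>. By Artin--Rees they can be corrected modulo \<open>J\<close> to satisfy the
  relations exactly. The resulting homomorphism \<open>M \<rightarrow> N\<close> agrees with \<open>\<phi>\<close> modulo \<open>J\<close> in a
  range of high degrees, so it is surjective there by Nakayama, and the same
  identification with a smaller chain element transports surjectivity modulo \<open>J\<close> back to
  low degrees. Exchanging the roles of \<open>M\<close> and \<open>N\<close> gives a surjection back, and a surjective endomorphism
  of a noetherian module is injective.
\<close>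

section \<open>Noetherian modules\<close>

text \<open>Linearity on a carrier only: graded components are subsets of an ambient type, and maps
  are arbitrary elsewhere. The combined equation copies the clause in \<open>gr_iso\<close>.\<close>

definition lin_on ::
  "('k::comm_ring_1 \<Rightarrow> 'm::ab_group_add \<Rightarrow> 'm) \<Rightarrow> ('k \<Rightarrow> 'n::ab_group_add \<Rightarrow> 'n)
   \<Rightarrow> 'm set \<Rightarrow> ('m \<Rightarrow> 'n) \<Rightarrow> bool" where
  "lin_on sc sc' S f \<longleftrightarrow> (\<forall>a. \<forall>u\<in>S. \<forall>v\<in>S. f (sc a u + v) = sc' a (f u) + f v)"

text \<open>Noetherianity stated by chains, which transfer directly along images and
  extensions.\<close>

definition acc_on :: "('k::comm_ring_1 \<Rightarrow> 'm::ab_group_add \<Rightarrow> 'm) \<Rightarrow> 'm set \<Rightarrow> bool" where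
  "acc_on sc S \<longleftrightarrow>
     (\<forall>T::nat \<Rightarrow> 'm set. (\<forall>i. module.subspace sc (T i) \<and> T i \<subseteq> S \<and> T i \<subseteq> T (Suc i))
        \<longrightarrow> (\<exists>n. \<forall>i\<ge>n. T i = T n))"

lemma lin_onD: "lin_on sc sc' S f \<Longrightarrow> u \<in> S \<Longrightarrow> v \<in> S \<Longrightarrow> f (sc a u + v) = sc' a (f u) + f v"
  by (auto simp: lin_on_def)

lemma lin_on_zero:
  assumes "module sc" "module sc'" "module.subspace sc S" "lin_on sc sc' S f"
  shows "f 0 = 0"
proof -
  interpret m: module sc by fact
  interpret n: module sc' by fact
  have "0 \<in> S" using assms(3) by (rule m.subspace_0)
  from lin_onD[OF assms(4) this this, of 1] show ?thesis by simp
qed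

lemma lin_on_add:
  assumes "module sc" "module sc'" "lin_on sc sc' S f" "u \<in> S" "v \<in> S"
  shows "f (u + v) = f u + f v"
proof -
  interpret m: module sc by fact
  interpret n: module sc' by fact
  from lin_onD[OF assms(3-5), of 1] show ?thesis by simp
qed

lemma lin_on_scale:
  assumes "module sc" "module sc'" "module.subspace sc S" "lin_on sc sc' S f" "u \<in> S"
  shows "f (sc a u) = sc' a (f u)"
proof -
  interpret m: module sc by fact
  interpret n: module sc' by fact
  have "0 \<in> S" using assms(3) by (rule m.subspace_0)
  from lin_onD[OF assms(4,5) this, of a] show ?thesis using lin_on_zero[OF assms(1-4)] by simp
qed

lemma lin_on_diff:
  assumes "module sc" "module sc'" "module.subspace sc S" "lin_on sc sc' S f" "u \<in> S" "v \<in> S"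
  shows "f (u - v) = f u - f v"
proof -
  interpret m: module sc by fact
  interpret n: module sc' by fact
  from lin_onD[OF assms(4,6,5), of "-1"] show ?thesis by simp
qed

lemma lin_on_sum:
  assumes "module sc" "module sc'" "module.subspace sc S" "lin_on sc sc' S f" "\<And>i. i \<in> I \<Longrightarrow> u i \<in> S"
  shows "f (\<Sum>i\<in>I. u i) = (\<Sum>i\<in>I. f (u i))"
proof -
  interpret m: module sc by fact
  show ?thesis using assms(5)
  proof (induction I rule: infinite_finite_induct)
    case (insert x F)
    have "(\<Sum>i\<in>F. u i) \<in> S" by (rule m.subspace_sum[OF assms(3)]) (use insert in auto)
    then show ?case using insert lin_on_add[OF assms(1,2,4)] by simp
  qed (auto simp: lin_on_zero[OF assms(1-4)])
qed

lemma lin_on_mono: "lin_on sc sc' S f \<Longrightarrow> T \<subseteq> S \<Longrightarrow> lin_on sc sc' T f"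
  by (auto simp: lin_on_def subset_iff)

lemma subspace_lin_image:
  assumes "module sc" "module sc'" "module.subspace sc S" "lin_on sc sc' S f"
  shows "module.subspace sc' (f ` S)"
proof -
  interpret m: module sc by fact
  interpret n: module sc' by fact
  show ?thesis
  proof (rule n.subspaceI)
    show "0 \<in> f ` S" using lin_on_zero[OF assms] m.subspace_0[OF assms(3)] by force
    show "x + y \<in> f ` S" if "x \<in> f ` S" "y \<in> f ` S" for x y
      using that lin_on_add[OF assms(1,2,4)] m.subspace_add[OF assms(3)] by (smt (verit) image_iff)
    show "sc' c x \<in> f ` S" if "x \<in> f ` S" for c x
      using that lin_on_scale[OF assms] m.subspace_scale[OF assms(3)] by (smt (verit) image_iff)
  qed
qed

lemma subspace_lin_preimage:
  assumes "module sc" "module sc'" "module.subspace sc S" "lin_on sc sc' S f" "module.subspace sc' T"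
  shows "module.subspace sc {x \<in> S. f x \<in> T}"
proof -
  interpret m: module sc by fact
  interpret n: module sc' by fact
  show ?thesis
    by (rule m.subspaceI)
      (auto simp: lin_on_zero[OF assms(1-4)] lin_on_add[OF assms(1,2,4)] lin_on_scale[OF assms(1-4)]
        m.subspace_0 m.subspace_add m.subspace_scale n.subspace_0 n.subspace_add n.subspace_scale assms(3,5))
qed

lemma acc_onD:
  assumes "acc_on sc S" "\<And>i. module.subspace sc (T i)" "\<And>i. T i \<subseteq> S" "\<And>i. T i \<subseteq> T (Suc i)"
  obtains n where "\<And>i. i \<ge> n \<Longrightarrow> T i = T n"
proof -
  have "\<exists>n. \<forall>i\<ge>n. T i = T n"
    by (rule assms(1)[unfolded acc_on_def, rule_format]) (use assms(2-4) in blast)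
  then show thesis using that by blast
qed

text \<open>Otherwise repeated choice of a strictly larger member gives a strictly increasing
  chain.\<close>

lemma acc_on_maximal:
  assumes "acc_on sc S" "A \<in> F" "\<And>X. X \<in> F \<Longrightarrow> module.subspace sc X \<and> X \<subseteq> S"
  obtains X where "X \<in> F" "\<And>Y. Y \<in> F \<Longrightarrow> X \<subseteq> Y \<Longrightarrow> Y = X"
proof (rule ccontr)
  assume *: "\<not> thesis"
  then have "\<forall>X\<in>F. \<exists>Y\<in>F. X \<subset> Y" using that by (metis psubsetI)
  then obtain h where h: "\<And>X. X \<in> F \<Longrightarrow> h X \<in> F \<and> X \<subset> h X" by metis
  define T where "T i = (h ^^ i) A" for i
  have T: "T i \<in> F" for i by (induction i) (auto simp: T_def assms(2) h)
  have T2: "T i \<subset> T (Suc i)" for i using h[OF T[of i]] by (auto simp: T_def)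
  obtain n where n: "\<And>i. i \<ge> n \<Longrightarrow> T i = T n"
  proof (rule acc_onD[OF assms(1), of T])
    show "module.subspace sc (T i)" "T i \<subseteq> S" for i using assms(3)[OF T] by auto
    show "T i \<subseteq> T (Suc i)" for i using T2 by blast
  qed blast
  have "T (Suc n) = T n" by (rule n) simp
  with T2[of n] show False by simp
qed

text \<open>A chain stops growing once its intersections with the kernel and its images both do: an
  element of the larger module has the image of some element of the smaller one, and the difference
  lies in the kernel.\<close>

lemma acc_on_extension:
  assumes "module sc" "module sc'" "module.subspace sc S" "lin_on sc sc' S f"
    "f ` S \<subseteq> T" "acc_on sc {x \<in> S. f x = 0}" "acc_on sc' T"
  shows "acc_on sc S"
proof -
  interpret m: module sc by fact
  interpret n: module sc' by fact
  show ?thesis unfolding acc_on_def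
  proof (intro allI impI)
    fix X :: "nat \<Rightarrow> _ set"
    assume X: "\<forall>i. module.subspace sc (X i) \<and> X i \<subseteq> S \<and> X i \<subseteq> X (Suc i)"
    have lin: "lin_on sc sc' (X i) f" for i using X lin_on_mono[OF assms(4)] by blast
    have mono: "X i \<subseteq> X j" if "i \<le> j" for i j using that X by (meson lift_Suc_mono_le)
    obtain n1 where n1: "\<And>i. i \<ge> n1 \<Longrightarrow> {x\<in>X i. f x \<in> {0}} = {x\<in>X n1. f x \<in> {0}}"
    proof (rule acc_onD[OF assms(6), of "\<lambda>i. {x\<in>X i. f x \<in> {0}}"])
      show "m.subspace {x\<in>X i. f x \<in> {0}}" for i
        by (rule subspace_lin_preimage[OF assms(1,2) _ lin]) (use X in auto)
    qed (use X in auto)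
    obtain n2 where n2: "\<And>i. i \<ge> n2 \<Longrightarrow> f ` X i = f ` X n2"
    proof (rule acc_onD[OF assms(7), of "\<lambda>i. f ` X i"])
      show "n.subspace (f ` X i)" for i
        using subspace_lin_image[OF assms(1,2) _ lin] X by blast
      show "f ` X i \<subseteq> T" for i using X assms(5) by (meson image_mono order_trans)
      show "f ` X i \<subseteq> f ` X (Suc i)" for i using X by (simp add: image_mono)
    qed blast
    define n where "n = max n1 n2"
    have "X i = X n" if i: "i \<ge> n" for i
    proof
      show "X n \<subseteq> X i" using mono i by auto
      show "X i \<subseteq> X n"
      proof
        fix x assume x: "x \<in> X i"
        have "f ` X i = f ` X n" using n2[of i] n2[of n] i by (auto simp: n_def)
        then obtain y where y: "y \<in> X n" "f x = f y" using x by (metis image_iff)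
        have yi: "y \<in> X i" using y mono i by auto
        have "f (x - y) = 0" using lin_on_diff[OF assms(1,2) _ lin x yi] X y by auto
        moreover have "x - y \<in> X i" using x yi X m.subspace_diff by auto
        ultimately have "x - y \<in> X n1" using n1[of i] i by (auto simp: n_def)
        then have "x - y \<in> X n" using mono[of n1 n] by (auto simp: n_def)
        then have "(x - y) + y \<in> X n" using y X m.subspace_add by blast
        then show "x \<in> X n" by simp
      qed
    qed
    then show "\<exists>n. \<forall>i\<ge>n. X i = X n" by blast
  qed
qed

text \<open>A chain in the image is recovered from the chain of its preimages in
  \<open>S\<close>.\<close>

lemma acc_on_image:
  assumes "module sc" "module sc'" "module.subspace sc S" "lin_on sc sc' S f" "acc_on sc S"
  shows "acc_on sc' (f ` S)"
  unfolding acc_on_def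
proof (intro allI impI)
  fix X :: "nat \<Rightarrow> _ set"
  assume X: "\<forall>i. module.subspace sc' (X i) \<and> X i \<subseteq> f ` S \<and> X i \<subseteq> X (Suc i)"
  obtain n where n: "\<And>i. i \<ge> n \<Longrightarrow> {x\<in>S. f x \<in> X i} = {x\<in>S. f x \<in> X n}"
  proof (rule acc_onD[OF assms(5), of "\<lambda>i. {x\<in>S. f x \<in> X i}"])
    show "module.subspace sc {x\<in>S. f x \<in> X i}" for i
      using subspace_lin_preimage[OF assms(1-4)] X by blast
    show "{x\<in>S. f x \<in> X i} \<subseteq> {x\<in>S. f x \<in> X (Suc i)}" for i
      using X by (simp add: subset_iff)
  qed auto
  have "X i \<subseteq> f ` S" for i using X by simp
  then have X_eq: "X i = f ` {x\<in>S. f x \<in> X i}" for i by blast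
  have "X i = X n" if "i \<ge> n" for i
    by (subst X_eq, subst n[OF that], rule X_eq[symmetric])
  then show "\<exists>n. \<forall>i\<ge>n. X i = X n" by blast
qed

lemma acc_on_zero: 
  assumes "module sc" shows "acc_on sc {0}"
proof -
  interpret module sc by fact
  have "T = {0}" if "subspace T" "T \<subseteq> {0}" for T using that subspace_0 by blast
  then show ?thesis unfolding acc_on_def by metis
qed

section \<open>Finite tuples with entries in prescribed submodules\<close>

abbreviation (input) fun_scale :: "('k \<Rightarrow> 'm \<Rightarrow> 'm) \<Rightarrow> 'k \<Rightarrow> (nat \<Rightarrow> 'm) \<Rightarrow> nat \<Rightarrow> 'm" where
  "fun_scale sc \<equiv> \<lambda>a f t. sc a (f t)"

text \<open>A finite product inside the function space; padding with 0 from \<open>q\<close> on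
  makes each tuple a unique function.\<close>

definition tuples :: "nat \<Rightarrow> (nat \<Rightarrow> 'm::zero set) \<Rightarrow> (nat \<Rightarrow> 'm) set" where
  "tuples q S = {f. (\<forall>t<q. f t \<in> S t) \<and> (\<forall>t\<ge>q. f t = 0)}"

lemma module_fun_scale:
  assumes "module sc" shows "module (fun_scale sc)"
proof -
  interpret module sc by fact
  show ?thesis by unfold_locales (auto simp: fun_eq_iff scale_right_distrib scale_left_distrib)
qed

lemma subspace_tuples:
  assumes "module sc" "\<And>t. t < q \<Longrightarrow> module.subspace sc (S t)"
  shows "module.subspace (fun_scale sc) (tuples q S)"
proof -
  interpret m: module sc by fact
  interpret f: module "fun_scale sc" by (rule module_fun_scale) fact
  show ?thesis
    by (rule f.subspaceI) (auto simp: tuples_def m.subspace_0 m.subspace_add m.subspace_scale assms(2))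
qed

text \<open>Induction on the length: the kernel of the projection to the last entry consists of the
  shorter tuples.\<close>

lemma acc_on_tuples:
  assumes "module sc" "\<And>t. t < q \<Longrightarrow> module.subspace sc (S t)" "\<And>t. t < q \<Longrightarrow> acc_on sc (S t)"
  shows "acc_on (fun_scale sc) (tuples q S)"
  using assms(2,3)
proof (induction q)
  case 0
  have "tuples 0 S = {0}" by (auto simp: tuples_def fun_eq_iff)
  then show ?case using acc_on_zero[OF module_fun_scale[OF assms(1)]] by metis
next
  case (Suc q)
  have zero: "0 \<in> S q" using Suc.prems(1)[THEN module.subspace_0[OF assms(1)], of q] by simp
  have *: "{f \<in> tuples (Suc q) S. f q = 0} = tuples q S"
  proof (intro set_eqI iffI)
    fix f assume "f \<in> {f \<in> tuples (Suc q) S. f q = 0}"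
    moreover have "t = q \<or> t \<ge> Suc q" if "t \<ge> q" for t using that by linarith
    ultimately show "f \<in> tuples q S" by (auto simp: tuples_def)
  next
    fix f assume "f \<in> tuples q S"
    then show "f \<in> {f \<in> tuples (Suc q) S. f q = 0}" using zero by (auto simp: tuples_def less_Suc_eq)
  qed
  show ?case
  proof (rule acc_on_extension[where f = "\<lambda>f. f q" and T = "S q"])
    show "module (fun_scale sc)" by (rule module_fun_scale[OF assms(1)])
    show "module.subspace (fun_scale sc) (tuples (Suc q) S)"
      by (rule subspace_tuples[OF assms(1) Suc.prems(1)])
    show "acc_on (fun_scale sc) {f \<in> tuples (Suc q) S. f q = 0}"
      unfolding * by (rule Suc.IH) (use Suc.prems in auto)
    show "acc_on sc (S q)" by (rule Suc.prems(2)) simp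
    show "lin_on (fun_scale sc) sc (tuples (Suc q) S) (\<lambda>f. f q)" by (simp add: lin_on_def)
    show "(\<lambda>f. f q) ` tuples (Suc q) S \<subseteq> S q" by (auto simp: tuples_def)
  qed (rule assms(1))
qed

section \<open>The base ring as a noetherian module\<close>

lemma module_mult: "module ((*) :: 'k::comm_ring_1 \<Rightarrow> _)"
  by unfold_locales (auto simp: algebra_simps)

lemma subspace_mult_iff: "module.subspace (*) I \<longleftrightarrow> is_ideal I"
  by (simp add: module.subspace_def[OF module_mult] is_ideal_def)

text \<open>The union of a chain of ideals is an ideal, and its finitely many generators already lie
  in one term.\<close>

lemma acc_on_UNIV:
  assumes "noetherian TYPE('k::comm_ring_1)"
  shows "acc_on (*) (UNIV :: 'k set)"
  unfolding acc_on_def subspace_mult_iff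
proof (intro allI impI)
  fix T :: "nat \<Rightarrow> 'k set"
  assume T: "\<forall>i. is_ideal (T i) \<and> T i \<subseteq> UNIV \<and> T i \<subseteq> T (Suc i)"
  then have mono: "T i \<subseteq> T j" if "i \<le> j" for i j using that by (meson lift_Suc_mono_le)
  have "is_ideal (\<Union>i. T i)"
    unfolding is_ideal_def
  proof (intro conjI ballI allI)
    show "0 \<in> (\<Union>i. T i)" using T by (auto simp: is_ideal_def)
    show "x + y \<in> (\<Union>i. T i)" if xy: "x \<in> (\<Union>i. T i)" "y \<in> (\<Union>i. T i)" for x y
    proof -
      obtain i j where "x \<in> T i" "y \<in> T j" using xy by auto
      then have "x \<in> T (max i j)" "y \<in> T (max i j)" using mono[of i "max i j"] mono[of j "max i j"] by auto
      then have "x + y \<in> T (max i j)" using T unfolding is_ideal_def by blast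
      then show ?thesis by blast
    qed
    show "r * x \<in> (\<Union>i. T i)" if x: "x \<in> (\<Union>i. T i)" for r x
    proof -
      obtain i where "x \<in> T i" using x by blast
      then have "r * x \<in> T i" using T unfolding is_ideal_def by blast
      then show ?thesis by blast
    qed
  qed
  then obtain F where F: "finite F" "F \<subseteq> (\<Union>i. T i)" "(\<Union>i. T i) = ideal_gen F"
    using assms unfolding noetherian_def by metis
  have "\<exists>n. F \<subseteq> T n"
    using F(1,2)
  proof (induction F)
    case (insert x F)
    then obtain n m where "F \<subseteq> T n" "x \<in> T m" by auto
    then have "insert x F \<subseteq> T (max n m)" using mono[of n "max n m"] mono[of m "max n m"] by auto
    then show ?case by blast
  qed auto
  then obtain n where n: "F \<subseteq> T n" by blast
  have sub: "module.subspace (*) (T n)" using T by (simp add: subspace_mult_iff)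
  have "ideal_gen F \<subseteq> T n"
    using n module.subspace_sum[OF module_mult sub] module.subspace_scale[OF module_mult sub]
    unfolding ideal_gen_def by (auto intro!: module.subspace_sum[OF module_mult sub])
  then have "T i = T n" if "i \<ge> n" for i using F(3) mono[OF that] by blast
  then show "\<exists>n. \<forall>i\<ge>n. T i = T n" by blast
qed

section \<open>The Jacobson radical\<close>

abbreviation (input) jac :: "'k::comm_ring_1 set" where "jac \<equiv> jacobson_radical TYPE('k)"

text \<open>The submodule \<open>J S\<close>; the span is taken because products alone need not be
  closed under addition.\<close>

definition jac_mult :: "('k::comm_ring_1 \<Rightarrow> 'm::ab_group_add \<Rightarrow> 'm) \<Rightarrow> 'm set \<Rightarrow> 'm set" where
  "jac_mult sc S = module.span sc {sc a s | a s. a \<in> jac \<and> s \<in> S}"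

text \<open>If \<open>T\<close> were proper, it would lie in a maximal proper submodule
  \<open>X\<close>. Then \<open>S / X\<close> is simple, hence annihilated by the Jacobson radical,
  so \<open>X\<close> contains \<open>T + J S\<close>, which is all of \<open>S\<close>.\<close>

lemma nakayama:
  assumes "module sc" "module.subspace sc S" "acc_on sc S" "module.subspace sc T" "T \<subseteq> S"
    "\<And>s. s \<in> S \<Longrightarrow> \<exists>t\<in>T. s - t \<in> jac_mult sc S"
  shows "T = S"
proof (rule ccontr)
  interpret module sc by fact
  assume "T \<noteq> S"
  define F where "F = {X. subspace X \<and> T \<subseteq> X \<and> X \<subset> S}"
  have "T \<in> F" using assms \<open>T \<noteq> S\<close> by (auto simp: F_def)
  then obtain X where X: "X \<in> F" "\<And>Y. Y \<in> F \<Longrightarrow> X \<subseteq> Y \<Longrightarrow> Y = X"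
    by (rule acc_on_maximal[OF assms(3)]) (auto simp: F_def)
  have sX: "subspace X" "T \<subseteq> X" "X \<subseteq> S" using X(1) by (auto simp: F_def)
  \<comment> \<open>Simplicity of \<open>S / X\<close>: by maximality of \<open>X\<close>, every
    \<open>w\<close> outside \<open>X\<close> generates \<open>S\<close> modulo
    \<open>X\<close>.\<close>
  have key: "\<exists>x\<in>X. \<exists>b. s = x + sc b w" if w: "w \<in> S" "w \<notin> X" and s: "s \<in> S" for w s
  proof -
    define Y where "Y = {x + sc b w | x b. x \<in> X}"
    have "subspace Y"
    proof (rule subspaceI)
      show "0 \<in> Y" unfolding Y_def using subspace_0[OF sX(1)]
        by (intro CollectI exI[of _ 0]) auto
      show "x + y \<in> Y" if xy: "x \<in> Y" "y \<in> Y" for x y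
      proof -
        obtain p b q c where "p \<in> X" "q \<in> X" "x = p + sc b w" "y = q + sc c w"
          using xy unfolding Y_def by blast
        then have "p + q \<in> X" "x + y = (p + q) + sc (b + c) w"
          using subspace_add[OF sX(1)] by (auto simp: scale_left_distrib)
        then show ?thesis by (auto simp: Y_def)
      qed
      show "sc c x \<in> Y" if "x \<in> Y" for c x
        using that subspace_scale[OF sX(1)] by (auto simp: Y_def scale_right_distrib) blast
    qed
    moreover have "X \<subseteq> Y"
    proof
      fix x assume "x \<in> X"
      then show "x \<in> Y" unfolding Y_def by (intro CollectI exI[of _ x] exI[of _ 0]) auto
    qed
    moreover have "w \<in> Y" unfolding Y_def using subspace_0[OF sX(1)]
      by (intro CollectI exI[of _ 0] exI[of _ 1]) auto
    moreover have "Y \<subseteq> S" using sX(3) w(1) subspace_add[OF assms(2)] subspace_scale[OF assms(2)]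
      by (auto simp: Y_def)
    ultimately have "Y = S" using X(2)[of Y] w(2) sX(2) by (auto simp: F_def)
    then show ?thesis using s by (auto simp: Y_def)
  qed
  obtain v where v: "v \<in> S" "v \<notin> X" using X(1) by (auto simp: F_def)
  \<comment> \<open>The annihilator of \<open>v\<close> modulo \<open>X\<close>; it is a maximal
    ideal because \<open>S / X\<close> is simple.\<close>
  define I where "I = {a. sc a v \<in> X}"
  have "maximal_ideal I"
    unfolding maximal_ideal_def
  proof (intro conjI allI impI)
    show "is_ideal I" unfolding is_ideal_def I_def
      using subspace_0[OF sX(1)] subspace_add[OF sX(1)] subspace_scale[OF sX(1)]
      by (auto simp: scale_left_distrib) (metis scale_scale)
    show "I \<noteq> UNIV"
    proof
      assume "I = UNIV"
      then have "1 \<in> I" by simp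
      then show False using v by (simp add: I_def)
    qed
    fix K assume K: "is_ideal K \<and> I \<subseteq> K"
    show "K = I \<or> K = UNIV"
    proof (cases "K \<subseteq> I")
      case False
      then obtain a where a: "a \<in> K" "sc a v \<notin> X" by (auto simp: I_def)
      \<comment> \<open>Since \<open>sc a v\<close> also generates modulo \<open>X\<close>, it
        recovers \<open>v\<close>; hence \<open>1 - b * a\<close> lies in \<open>I\<close>, which
        forces 1 into \<open>K\<close>.\<close>
      obtain x b where x: "x \<in> X" "v = x + sc b (sc a v)"
        using key[OF _ a(2) v(1)] subspace_scale[OF assms(2) v(1)] by blast
      have "sc (1 - b * a) v = x" using x(2) by (simp add: scale_left_diff_distrib diff_eq_eq)
      then have "1 - b * a \<in> K" using x(1) K by (auto simp: I_def)
      moreover have "b * a \<in> K" using K a by (auto simp: is_ideal_def)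
      ultimately have "(1 - b * a) + b * a \<in> K" using K unfolding is_ideal_def by blast
      then have one: "1 \<in> K" by simp
      have "c \<in> K" for c using K one unfolding is_ideal_def by (metis mult.right_neutral)
      then show ?thesis by auto
    qed (use K in auto)
  qed
  then have jI: "jac \<subseteq> I" by (auto simp: jacobson_radical_def)
  have "sc a s \<in> X" if as: "a \<in> jac" "s \<in> S" for a s
  proof -
    obtain x b where x: "x \<in> X" "s = x + sc b v" using key[OF v as(2)] by blast
    have "sc a v \<in> X" using jI as(1) by (auto simp: I_def)
    then have "sc b (sc a v) \<in> X" by (rule subspace_scale[OF sX(1)])
    then have "sc a (sc b v) \<in> X" by (simp add: mult.commute)
    moreover have "sc a x \<in> X" by (rule subspace_scale[OF sX(1) x(1)])
    ultimately show ?thesis using x(2) subspace_add[OF sX(1)] by (simp add: scale_right_distrib)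
  qed
  then have jX: "jac_mult sc S \<subseteq> X" unfolding jac_mult_def
    by (intro span_minimal sX(1)) auto
  obtain t where "t \<in> T" "v - t \<in> jac_mult sc S" using assms(6)[OF v(1)] by blast
  then have "(v - t) + t \<in> X" using jX sX(2) subspace_add[OF sX(1)] by blast
  then show False using v(2) by simp
qed

text \<open>Nakayama for the principal ideal of \<open>y\<close> in \<open>k\<close>: every
  \<open>s\<close> differs from \<open>s * y\<close> by a multiple of \<open>j\<close>.\<close>

lemma unit_of_jac:
  assumes "noetherian TYPE('k::comm_ring_1)" "(j::'k) \<in> jac" "y + b * j = 1"
  shows "y dvd 1"
proof -
  have "{c * y | c. True} = UNIV"
  proof (rule nakayama[OF module_mult _ acc_on_UNIV[OF assms(1)]])
    show "module.subspace (*) {c * y | c. True}"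
    proof (rule module.subspaceI[OF module_mult])
      show "0 \<in> {c * y | c. True}" by (auto intro: exI[of _ 0])
      fix u v assume "u \<in> {c * y | c. True}" "v \<in> {c * y | c. True}"
      then obtain c d where "u = c * y" "v = d * y" by blast
      then have "u + v = (c + d) * y" by (simp add: distrib_right)
      then show "u + v \<in> {c * y | c. True}" by blast
    next
      fix b u assume "u \<in> {c * y | c. True}"
      then obtain c where "u = c * y" by blast
      then have "b * u = (b * c) * y" by (simp add: mult.assoc)
      then show "b * u \<in> {c * y | c. True}" by blast
    qed
    show "\<exists>t\<in>{c * y | c. True}. s - t \<in> jac_mult (*) UNIV" for s
    proof (intro bexI)
      have "s - s * y = s * (y + b * j) - s * y" by (simp add: assms(3))
      also have "\<dots> = j * (b * s)" by (simp add: algebra_simps)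
      finally show "s - s * y \<in> jac_mult (*) UNIV" unfolding jac_mult_def
        using assms(2) by (intro module.span_base[OF module_mult]) blast
    qed auto
  qed (auto simp: subspace_mult_iff is_ideal_def)
  then have "1 \<in> {c * y | c. True}" by simp
  then obtain c where "1 = c * y" by auto
  then show ?thesis by (metis dvd_triv_right)
qed

text \<open>Weak Artin--Rees: if \<open>C\<close> is maximal with \<open>C \<inter> B = X\<close>, then
  the submodules \<open>{q. P\<^sub>r q \<in> C}\<close> increase with \<open>r\<close>; once they are stationary,
  \<open>(C + P\<^sub>r S) \<inter> B = X\<close>, so that \<open>P\<^sub>r S \<subseteq> C\<close> by maximality.\<close>

lemma artin_rees:
  fixes a :: "nat \<Rightarrow> 'k::comm_ring_1"
  assumes "module sc" "module.subspace sc S" "acc_on sc S"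
    and "module.subspace sc B" "B \<subseteq> S" "module.subspace sc X" "X \<subseteq> B"
    and "\<And>i b. b \<in> B \<Longrightarrow> sc (a i) b \<in> X"
  obtains r where "\<And>q. q \<in> S \<Longrightarrow> sc (\<Prod>i<Suc r. a i) q \<in> B \<Longrightarrow> sc (\<Prod>i<Suc r. a i) q \<in> X"
proof -
  interpret module sc by fact
  define F where "F = {C. subspace C \<and> C \<subseteq> S \<and> C \<inter> B = X}"
  have "X \<in> F" using assms by (auto simp: F_def)
  then obtain C where C: "C \<in> F" "\<And>Y. Y \<in> F \<Longrightarrow> C \<subseteq> Y \<Longrightarrow> Y = C"
    by (rule acc_on_maximal[OF assms(3)]) (auto simp: F_def)
  have sC: "subspace C" "C \<subseteq> S" "C \<inter> B = X" using C(1) by (auto simp: F_def)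
  define P where "P r = (\<Prod>i<r. a i)" for r
  have PS: "P (Suc r) = a r * P r" for r by (simp add: P_def mult.commute)
  obtain r where r: "\<And>i. i \<ge> r \<Longrightarrow> {q\<in>S. sc (P i) q \<in> C} = {q\<in>S. sc (P r) q \<in> C}"
  proof (rule acc_onD[OF assms(3), of "\<lambda>r. {q\<in>S. sc (P r) q \<in> C}"])
    show "subspace {q \<in> S. sc (P i) q \<in> C}" for i
      by (rule subspace_lin_preimage[OF assms(1,1,2) _ sC(1)])
        (auto simp: lin_on_def scale_right_distrib mult.commute)
    show "{q \<in> S. sc (P i) q \<in> C} \<subseteq> {q \<in> S. sc (P (Suc i)) q \<in> C}" for i
      using subspace_scale[OF sC(1)] by (auto simp: PS simp flip: scale_scale)
  qed auto
  define Y where "Y = {c + sc (P r) q | c q. c \<in> C \<and> q \<in> S}"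
  have "Y \<in> F" unfolding F_def
  proof (intro CollectI conjI)
    show "subspace Y"
    proof (rule subspaceI)
      show "0 \<in> Y" unfolding Y_def using subspace_0[OF sC(1)] subspace_0[OF assms(2)]
        by (intro CollectI exI[of _ 0]) auto
      show "x + y \<in> Y" if xy: "x \<in> Y" "y \<in> Y" for x y
      proof -
        obtain p b q c where *: "p \<in> C" "q \<in> C" "b \<in> S" "c \<in> S" "x = p + sc (P r) b" "y = q + sc (P r) c"
          using xy unfolding Y_def by blast
        then have "p + q \<in> C" "b + c \<in> S" "x + y = (p + q) + sc (P r) (b + c)"
          using subspace_add[OF sC(1)] subspace_add[OF assms(2)] by (auto simp: scale_right_distrib)
        then show ?thesis unfolding Y_def by blast
      qed
      show "sc c x \<in> Y" if x: "x \<in> Y" for c x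
      proof -
        obtain p b where *: "p \<in> C" "b \<in> S" "x = p + sc (P r) b"
          using x unfolding Y_def by blast
        then have "sc c p \<in> C" "sc c b \<in> S" "sc c x = sc c p + sc (P r) (sc c b)"
          using subspace_scale[OF sC(1)] subspace_scale[OF assms(2)]
          by (auto simp: scale_right_distrib mult.commute)
        then show ?thesis unfolding Y_def by blast
      qed
    qed
    show "Y \<subseteq> S" using sC(2) subspace_add[OF assms(2)] subspace_scale[OF assms(2)] by (auto simp: Y_def)
    show "Y \<inter> B = X"
    proof
      show "X \<subseteq> Y \<inter> B"
      proof
        fix x assume "x \<in> X"
        then show "x \<in> Y \<inter> B" unfolding Y_def using sC(3) subspace_0[OF assms(2)]
          by (intro IntI CollectI exI[of _ x] exI[of _ 0]) auto
      qed
      show "Y \<inter> B \<subseteq> X"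
      proof
        fix b assume b: "b \<in> Y \<inter> B"
        then obtain c q where c: "c \<in> C" "q \<in> S" "b = c + sc (P r) q" by (auto simp: Y_def)
        \<comment> \<open>Multiplying by \<open>a r\<close> moves \<open>b\<close> into
          \<open>X\<close>, so \<open>P (Suc r)\<close> times \<open>q\<close> lies in
          \<open>C\<close>; stationarity lowers this to \<open>P r\<close> times
          \<open>q\<close>.\<close>
        have "sc (a r) b \<in> C" using assms(8) b sC(3) by blast
        then have "sc (a r) b - sc (a r) c \<in> C"
          using c(1) subspace_diff[OF sC(1)] subspace_scale[OF sC(1)] by blast
        then have "sc (P (Suc r)) q \<in> C" using c(3) by (simp add: PS scale_right_distrib)
        then have "sc (P r) q \<in> C" using r[of "Suc r"] c(2) by auto
        then have "b \<in> C" using c subspace_add[OF sC(1)] by simp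
        then show "b \<in> X" using sC(3) b by auto
      qed
    qed
  qed
  moreover have "C \<subseteq> Y"
  proof
    fix x assume "x \<in> C"
    then show "x \<in> Y" unfolding Y_def using subspace_0[OF assms(2)]
      by (intro CollectI exI[of _ x] exI[of _ 0]) auto
  qed
  ultimately have "Y = C" using C(2) by blast
  have "sc (P r) q \<in> Y" if "q \<in> S" for q
    unfolding Y_def using that subspace_0[OF sC(1)]
    by (intro CollectI exI[of _ 0] exI[of _ q]) auto
  \<comment> \<open>\<open>r\<close> factors already suffice here; passing to \<open>Suc r\<close>
    makes the product nonempty, so that it lies in the Jacobson radical when the factors do.\<close>
  then have "sc (P (Suc r)) q \<in> C" if "q \<in> S" for q
    using that subspace_scale[OF sC(1)] \<open>Y = C\<close> by (simp add: PS flip: scale_scale)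
  then show ?thesis using that[of r] sC(3) unfolding P_def by blast
qed

text \<open>The kernels of the iterates stabilise at some \<open>n\<close>. A kernel element has the
  form \<open>(f ^^ n) y\<close>; then \<open>y\<close> is killed by \<open>f ^^ Suc n\<close>,
  hence already by \<open>f ^^ n\<close>.\<close>

lemma inj_on_surj_endo:
  assumes "module sc" "module.subspace sc S" "acc_on sc S" "lin_on sc sc S f" "f ` S = S"
  shows "inj_on f S"
proof -
  interpret module sc by fact
  have im: "(f ^^ n) ` S = S" for n
  proof (induction n)
    case (Suc n)
    have "(f ^^ Suc n) ` S = f ` (f ^^ n) ` S" by (simp add: image_comp)
    then show ?case using Suc assms(5) by simp
  qed simp
  have mem: "x \<in> S \<Longrightarrow> (f ^^ n) x \<in> S" for x n using im[of n] by blast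
  have lin: "lin_on sc sc S (f ^^ n)" for n
  proof (induction n)
    case (Suc n)
    then show ?case using assms(4) mem[of _ n] by (simp add: lin_on_def)
  qed (simp add: lin_on_def)
  obtain n where n: "\<And>i. i \<ge> n \<Longrightarrow> {x\<in>S. (f ^^ i) x \<in> {0}} = {x\<in>S. (f ^^ n) x \<in> {0}}"
  proof (rule acc_onD[OF assms(3), of "\<lambda>i. {x\<in>S. (f ^^ i) x \<in> {0}}"])
    show "subspace {x\<in>S. (f ^^ i) x \<in> {0}}" for i
      by (rule subspace_lin_preimage[OF assms(1,1,2) lin]) simp
    show "{x\<in>S. (f ^^ i) x \<in> {0}} \<subseteq> {x\<in>S. (f ^^ Suc i) x \<in> {0}}" for i
      using lin_on_zero[OF assms(1,1,2,4)] by auto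
  qed auto
  have ker: "x = 0" if x: "x \<in> S" "f x = 0" for x
  proof -
    obtain y where y: "y \<in> S" "x = (f ^^ n) y" using im[of n] x(1) by blast
    then have "(f ^^ Suc n) y = 0" using x(2) by simp
    then have "(f ^^ n) y = 0" using n[of "Suc n"] y(1) by auto
    then show ?thesis using y(2) by simp
  qed
  show ?thesis
  proof (rule inj_onI)
    fix x y assume "x \<in> S" "y \<in> S" "f x = f y"
    then have "x - y = 0"
      using ker[of "x - y"] lin_on_diff[OF assms(1,1,2,4)] subspace_diff[OF assms(2)] by simp
    then show "x = y" by simp
  qed
qed

section \<open>Structure constants\<close>

text \<open>Makes the natural-number subtractions in \<open>eps\<close> exact.\<close>

lemma div_add_superadditive: "(a::nat) div j + b div j \<le> (a + b) div j"
  using div_add1_eq[of a b j] by linarith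

lemma eps_commute: "eps j a b = eps j b a"
  by (simp add: eps_def add.commute)

text \<open>\<open>eps\<close> is the coboundary of the floor function: both sides equal the floor
  of the total minus the floors of the three summands.\<close>

lemma eps_cocycle: "eps j b a + eps j (a + b) c = eps j b c + eps j (b + c) a"
  using div_add_superadditive[of a j b] div_add_superadditive[of "a + b" j c]
    div_add_superadditive[of b j c] div_add_superadditive[of "b + c" j a]
  by (simp add: eps_def add_ac)

text \<open>Factors beyond \<open>n\<close> have exponent 0; a common index range lets several
  structure constants be multiplied factor by factor.\<close>

lemma Cf_extend: "m \<le> n \<Longrightarrow> n \<le> K \<Longrightarrow> Cf \<pi> n m = (\<Prod>j\<in>{2..K}. \<pi> j ^ eps j (n - m) m)"
  unfolding Cf_def by (rule prod.mono_neutral_left) (auto simp: eps_def)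

lemma Cf_sym: "Cf \<pi> (a + b) a = Cf \<pi> (a + b) b"
  by (simp add: Cf_def eps_commute)

text \<open>Associativity of the product of \<open>x^[a]\<close>, \<open>x^[b]\<close> and
  \<open>x^[c]\<close>, obtained from the cocycle identity in each exponent.\<close>

lemma Cf_assoc:
  "Cf \<pi> (a + b) a * Cf \<pi> (a + b + c) c = Cf \<pi> (b + c) c * Cf \<pi> (a + b + c) a"
proof -
  let ?K = "a + b + c"
  have "Cf \<pi> (a + b) a * Cf \<pi> ?K c = (\<Prod>j\<in>{2..?K}. \<pi> j ^ (eps j b a + eps j (a + b) c))"
    using Cf_extend[of a "a + b" ?K \<pi>] Cf_extend[of c ?K ?K \<pi>]
    by (simp add: prod.distrib power_add)
  also have "\<dots> = (\<Prod>j\<in>{2..?K}. \<pi> j ^ (eps j b c + eps j (b + c) a))"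
    by (rule prod.cong[OF refl], subst eps_cocycle, rule refl)
  also have "\<dots> = Cf \<pi> (b + c) c * Cf \<pi> ?K a"
    using Cf_extend[of c "b + c" ?K \<pi>] Cf_extend[of a ?K ?K \<pi>]
    by (simp add: prod.distrib power_add add.assoc)
  finally show ?thesis .
qed

text \<open>Multiplication by \<open>x\<^sup>[\<^sup>N\<^sup>]\<close> is, up to units, a relabelling of the basis in degrees below
  \<open>N\<close>, whereas \<open>x\<^sup>[\<^sup>N\<^sup>-\<^sup>i\<^sup>] x\<^sup>[\<^sup>p\<^sup>+\<^sup>i\<^sup>]\<close>, where the addition of the indices carries past \<open>N\<close>,
  is divisible by \<open>P\<close>.\<close>

definition pivot :: "(nat \<Rightarrow> 'k::comm_ring_1) \<Rightarrow> nat \<Rightarrow> 'k \<Rightarrow> nat \<Rightarrow> bool" where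
  "pivot \<pi> N P B \<longleftrightarrow> B \<le> N \<and> (\<forall>b<N. Cf \<pi> (N + b) N dvd 1) \<and>
     (\<forall>p i. 1 \<le> i \<and> p + i < B \<longrightarrow> P dvd Cf \<pi> (N + p) (N - i))"

text \<open>The sequence lists the values of \<open>\<pi>\<close> in the Jacobson radical at indices
  beyond \<open>B\<close>. These indices form a divisibility chain, and the \<open>r\<close>-th one
  is a pivot for the product of the \<open>r\<close> values before it.\<close>

lemma pivot_sequence:
  fixes \<pi> :: "nat \<Rightarrow> 'k::comm_ring_1"
  assumes noeth: "noetherian TYPE('k)" and adm: "admissible \<pi>"
    and inf: "infinite {n. \<pi> n \<in> (jac :: 'k set)}" and nontriv: "(1::'k) \<noteq> 0"
  shows "\<exists>a::nat \<Rightarrow> 'k. (\<forall>i. a i \<in> jac) \<and> (\<forall>r. \<exists>N. pivot \<pi> N (\<Prod>i<r. a i) B)"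
proof -
  have no_unit: "\<not> j dvd 1" if j: "j \<in> jac" for j :: 'k
  proof
    assume "j dvd 1"
    then obtain b where "0 + b * j = 1" by (metis dvdE mult.commute add_0)
    then have "(0::'k) dvd 1" by (rule unit_of_jac[OF noeth j])
    then show False using nontriv by simp
  qed
  \<comment> \<open>If the two values generate the unit ideal, the one at \<open>m\<close> is
    absorbed by the Jacobson radical and the one at \<open>n\<close> is a unit; otherwise
    admissibility applies.\<close>
  have comparable: "n dvd m \<or> m dvd n \<or> \<pi> n dvd 1" if n: "1 \<le> n" and m: "1 \<le> m" "\<pi> m \<in> jac" for n m
  proof (cases "\<exists>a b. a * \<pi> n + b * \<pi> m = 1")
    case True
    then obtain a b where "a * \<pi> n + b * \<pi> m = 1" by blast
    then have "a * \<pi> n dvd 1" by (rule unit_of_jac[OF noeth m(2)])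
    then show ?thesis using dvd_mult_right by blast
  qed (use adm n m in \<open>auto simp: admissible_def\<close>)
  \<comment> \<open>Indices beyond \<open>B\<close> dominate all shifts below \<open>B\<close>;
    being beyond 2 makes them positive and keeps them in the range of the product defining
    \<open>Cf\<close>.\<close>
  define A where "A = {n. \<pi> n \<in> jac} - {..max B 2}"
  have "infinite A" unfolding A_def using inf by simp
  define nu where "nu = enumerate A"
  have nu_mem: "nu i \<in> A" for i using enumerate_in_set[OF \<open>infinite A\<close>] by (simp add: nu_def)
  have nu: "\<pi> (nu i) \<in> jac" "B < nu i" "2 < nu i" for i using nu_mem[of i] by (auto simp: A_def)
  have nu_mono: "nu i < nu k" if "i < k" for i k
    using enumerate_mono[OF that \<open>infinite A\<close>] by (simp add: nu_def)
  have nu_dvd: "nu i dvd nu k" if "i < k" for i k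
    using comparable[of "nu i" "nu k"] nu[of i] nu[of k] no_unit[OF nu(1)[of i]] nu_mono[OF that]
    by (auto dest: dvd_imp_le)
  have "pivot \<pi> (nu r) (\<Prod>i<r. \<pi> (nu i)) B" for r
    unfolding pivot_def
  proof (intro conjI allI impI)
    let ?N = "nu r"
    show "B \<le> ?N" using nu(2)[of r] by simp
    fix b assume b: "b < ?N"
    \<comment> \<open>If \<open>j\<close> and \<open>?N\<close> are comparable, adding
      \<open>b < ?N\<close> to \<open>?N\<close> produces no carry at \<open>j\<close>, so the
      exponent is 0; otherwise the base is a unit.\<close>
    have "\<pi> j ^ eps j b ?N dvd 1" if j: "j \<in> {2..?N + b}" for j
    proof -
      consider (dvd) "j dvd ?N" | (mult) "?N dvd j" | (unit) "\<pi> j dvd 1"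
        using comparable[of j ?N] nu[of r] j by auto
      then show ?thesis
      proof cases
        case dvd
        then obtain q where q: "?N = j * q" by blast
        have "eps j b ?N = 0" using j unfolding q eps_def by simp
        then show ?thesis by simp
      next
        case mult
        then obtain q where q: "j = ?N * q" by blast
        have "(b + ?N) div j = 1 div q"
          using b by (simp add: q div_mult2_eq)
        moreover have "?N div j = 1 div q" using nu(3)[of r] by (simp add: q div_mult2_eq)
        ultimately have "eps j b ?N = 0" by (simp add: eps_def)
        then show ?thesis by simp
      next
        case unit
        then show ?thesis by (metis dvd_power_same power_one)
      qed
    qed
    then have "(\<Prod>j\<in>{2..?N + b}. \<pi> j ^ eps j b ?N) dvd (\<Prod>j\<in>{2..?N + b}. 1)"
      by (rule prod_dvd_prod)
    then show "Cf \<pi> (?N + b) ?N dvd 1" by (simp add: Cf_def)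
  next
    let ?N = "nu r"
    fix p i assume pi: "1 \<le> i \<and> p + i < B"
    then have iN: "i \<le> ?N" using nu(2)[of r] by linarith
    have inj: "inj_on nu {..<r}"
      using nu_mono by (metis inj_onI linorder_neqE_nat less_irrefl)
    have "(\<Prod>k<r. \<pi> (nu k)) = (\<Prod>j\<in>nu ` {..<r}. \<pi> j)"
      using prod.reindex[OF inj, of \<pi>] by simp
    \<comment> \<open>Each earlier \<open>j\<close> divides \<open>?N\<close> and exceeds
      \<open>p + i\<close>. Adding \<open>p + i\<close> to \<open>?N - i\<close> therefore passes
      the multiple \<open>?N\<close> of \<open>j\<close>, which is exactly one carry.\<close>
    also have "\<dots> dvd (\<Prod>j\<in>nu ` {..<r}. \<pi> j ^ eps j (p + i) (?N - i))"
    proof (rule prod_dvd_prod)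
      fix j assume "j \<in> nu ` {..<r}"
      then obtain k where k: "k < r" "j = nu k" by blast
      obtain q where q: "?N = j * q" using nu_dvd[OF k(1)] k(2) by blast
      have B: "B < j" using nu k by simp
      have q0: "q \<noteq> 0" using q nu(3)[of r] by (metis mult_0_right not_less_zero)
      have "(p + i + (?N - i)) div j = (p + j * q) div j" using iN by (simp add: q)
      also have "\<dots> = q" using pi B by simp
      finally have 1: "(p + i + (?N - i)) div j = q" .
      have "?N - i = (j - i) + j * (q - 1)"
        using pi B q0 unfolding q by (cases q) simp_all
      then have "(?N - i) div j = (j - i) div j + (q - 1)" using B by simp
      then have 2: "(?N - i) div j = q - 1" using pi B by simp
      have 3: "(p + i) div j = 0" using pi B by simp
      have "eps j (p + i) (?N - i) = 1" using 1 2 3 q0 by (simp add: eps_def)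
      then show "\<pi> j dvd \<pi> j ^ eps j (p + i) (?N - i)" by simp
    qed
    also have "\<dots> dvd (\<Prod>j\<in>{2..?N + p}. \<pi> j ^ eps j (p + i) (?N - i))"
    proof (rule prod_dvd_prod_subset)
      show "nu ` {..<r} \<subseteq> {2..?N + p}"
      proof
        fix j assume "j \<in> nu ` {..<r}"
        then obtain k where "k < r" "j = nu k" by blast
        then show "j \<in> {2..?N + p}" using nu_mono[of k r] nu(3)[of k] by simp
      qed
    qed simp
    also have "\<dots> = Cf \<pi> (?N + p) (?N - i)" using iN by (simp add: Cf_def add.commute)
    finally show "(\<Prod>k<r. \<pi> (nu k)) dvd Cf \<pi> (?N + p) (?N - i)" .
  qed
  then show ?thesis using nu(1) by (intro exI[of _ "\<lambda>i. \<pi> (nu i)"]) blast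
qed

section \<open>Graded modules and presentations\<close>

locale graded_module =
  fixes \<pi> :: "nat \<Rightarrow> 'k::comm_ring_1" and sc :: "'k \<Rightarrow> 'm::ab_group_add \<Rightarrow> 'm"
    and M :: "int \<Rightarrow> 'm set" and act :: "nat \<Rightarrow> int \<Rightarrow> 'm \<Rightarrow> 'm"
  assumes gr: "graded_Dmod \<pi> sc M act"

sublocale graded_module \<subseteq> module sc
  using gr by (simp add: graded_Dmod_def)

context graded_module
begin

lemma sub: "subspace (M j)"
  using gr by (simp add: graded_Dmod_def)

lemma act_in: "v \<in> M j \<Longrightarrow> j' = j + int i \<Longrightarrow> act i j v \<in> M j'"
  using gr by (simp add: graded_Dmod_def)

lemma act_lin: "lin_on sc sc (M j) (act i j)"
  using gr by (simp add: graded_Dmod_def lin_on_def)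

lemma act_act:
  "v \<in> M j \<Longrightarrow> j' = j + int m \<Longrightarrow> act i j' (act m j v) = sc (Cf \<pi> (i + m) m) (act (i + m) j v)"
  using gr by (simp add: graded_Dmod_def)

text \<open>Commutativity of \<open>D\<close>; it later moves \<open>x^[N]\<close> past elements of
  small degree.\<close>

lemma act_comm:
  assumes "v \<in> M j" "j' = j + int m" "j'' = j + int i"
  shows "act i j' (act m j v) = act m j'' (act i j v)"
  using act_act[OF assms(1,2), of i] act_act[OF assms(1,3), of m] Cf_sym[of \<pi> i m]
  by (simp add: add.commute)

lemma act_zero: "act i j 0 = 0"
  by (rule lin_on_zero[OF module_axioms module_axioms sub act_lin])

lemma act_scale: "v \<in> M j \<Longrightarrow> act i j (sc a v) = sc a (act i j v)"
  by (rule lin_on_scale[OF module_axioms module_axioms sub act_lin])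

lemma act_diff: "u \<in> M j \<Longrightarrow> v \<in> M j \<Longrightarrow> act i j (u - v) = act i j u - act i j v"
  by (rule lin_on_diff[OF module_axioms module_axioms sub act_lin])

lemma act_sum: "(\<And>t. t \<in> I \<Longrightarrow> u t \<in> M j) \<Longrightarrow> act i j (\<Sum>t\<in>I. u t) = (\<Sum>t\<in>I. act i j (u t))"
  by (rule lin_on_sum[OF module_axioms module_axioms sub act_lin])

lemma pres_term_in:
  assumes "\<forall>s<r. u s \<in> M (d s)" "s < r" "d s \<le> j"
  shows "act (nat (j - d s)) (d s) (u s) \<in> M j"
  using assms by (intro act_in) auto

lemma pres_in:
  assumes "\<forall>s<r. u s \<in> M (d s)"
  shows "pres_map sc act r d u j c \<in> M j"
  unfolding pres_map_def
  by (rule subspace_sum[OF sub]) (auto intro!: subspace_scale[OF sub] pres_term_in[OF assms])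

lemma pres_lin: "lin_on (fun_scale (*)) sc S (pres_map sc act r d u j)"
  by (simp add: lin_on_def pres_map_def scale_left_distrib sum.distrib scale_sum_right)

lemma pres_scale: "pres_map sc act r d u j (\<lambda>s. a * c s) = sc a (pres_map sc act r d u j c)"
  by (simp add: pres_map_def scale_sum_right)

lemma pres_diff:
  "pres_map sc act r d u j (\<lambda>s. c s - b s) = pres_map sc act r d u j c - pres_map sc act r d u j b"
  by (simp add: pres_map_def scale_left_diff_distrib sum_subtractf)

lemma pres_add:
  "pres_map sc act r d u j (\<lambda>s. c s + b s) = pres_map sc act r d u j c + pres_map sc act r d u j b"
  by (simp add: pres_map_def scale_left_distrib sum.distrib)

lemma pres_comb:
  "pres_map sc act r d u j (\<lambda>s. \<Sum>t\<in>I. a t * k t s) = (\<Sum>t\<in>I. sc (a t) (pres_map sc act r d u j (k t)))"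
  unfolding pres_map_def scale_sum_left scale_sum_right by (subst sum.swap) simp

lemma pres_cong:
  "(\<And>s. s < r \<Longrightarrow> d s \<le> j \<Longrightarrow> c s = b s) \<Longrightarrow> pres_map sc act r d u j c = pres_map sc act r d u j b"
  by (simp add: pres_map_def)

text \<open>Linearity in the images of the generators, with coefficients fixed: evaluating a
  relation is a linear map on candidate tuples.\<close>

lemma pres_lin_gens:
  assumes "\<forall>s<r. u s \<in> M (d s)" "\<forall>s<r. v s \<in> M (d s)"
  shows "pres_map sc act r d (\<lambda>s. sc a (u s) + v s) j c =
    sc a (pres_map sc act r d u j c) + pres_map sc act r d v j c"
proof -
  have "act i (d s) (sc a (u s) + v s) = sc a (act i (d s) (u s)) + act i (d s) (v s)" if "s < r" for i s
    using lin_onD[OF act_lin] assms that by blast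
  then show ?thesis
    by (simp add: pres_map_def scale_right_distrib sum.distrib scale_sum_right mult.commute)
qed

text \<open>\<open>D\<close>-linearity of the map out of the free module, for arbitrary images
  \<open>u\<close> of its basis.\<close>

lemma pres_act:
  assumes "\<forall>s<r. u s \<in> M (d s)" "j' = j + int i"
  shows "act i j (pres_map sc act r d u j c) = pres_map sc act r d u j' (free_act \<pi> r d i j c)"
proof -
  have "act i j (pres_map sc act r d u j c) =
      (\<Sum>s\<in>{s. s < r \<and> d s \<le> j}. act i j (sc (c s) (act (nat (j - d s)) (d s) (u s))))"
    unfolding pres_map_def
    by (rule act_sum) (auto intro!: subspace_scale[OF sub] pres_term_in[OF assms(1)])
  also have "\<dots> = (\<Sum>s\<in>{s. s < r \<and> d s \<le> j}. sc (free_act \<pi> r d i j c s) (act (nat (j' - d s)) (d s) (u s)))"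
  proof (rule sum.cong[OF refl])
    fix s assume s: "s \<in> {s. s < r \<and> d s \<le> j}"
    have "nat (j' - d s) = i + nat (j - d s)" using s assms(2) by auto
    moreover have "act i j (act (nat (j - d s)) (d s) (u s)) =
      sc (Cf \<pi> (i + nat (j - d s)) (nat (j - d s))) (act (i + nat (j - d s)) (d s) (u s))"
      by (rule act_act) (use s assms(1) in auto)
    ultimately show "act i j (sc (c s) (act (nat (j - d s)) (d s) (u s))) =
        sc (free_act \<pi> r d i j c s) (act (nat (j' - d s)) (d s) (u s))"
      using s by (simp add: act_scale pres_term_in[OF assms(1)] free_act_def mult.commute)
  qed
  \<comment> \<open>In degree \<open>j'\<close> more generators may occur, but
    \<open>free_act\<close> has coefficient 0 at those.\<close>
  also have "\<dots> = pres_map sc act r d u j' (free_act \<pi> r d i j c)"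
    unfolding pres_map_def using assms(2)
    by (intro sum.mono_neutral_left) (auto simp: free_act_def)
  finally show ?thesis .
qed

text \<open>Any \<open>u\<close> killing the relations \<open>h t\<close> kills the submodule they
  generate.\<close>

lemma pres_relations:
  assumes "\<forall>s<r. u s \<in> M (d s)"
    and "\<And>t. t \<in> I \<Longrightarrow> e t \<le> j \<and> pres_map sc act r d u (e t) (h t) = 0"
  shows "pres_map sc act r d u j (\<lambda>s. \<Sum>t\<in>I. a t * free_act \<pi> r d (nat (j - e t)) (e t) (h t) s) = 0"
proof -
  have "pres_map sc act r d u j (free_act \<pi> r d (nat (j - e t)) (e t) (h t)) = 0" if "t \<in> I" for t
    using pres_act[OF assms(1), of j "e t" "nat (j - e t)" "h t"] assms(2)[OF that] by (simp add: act_zero)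
  then show ?thesis unfolding pres_comb by simp
qed

end

section \<open>Fixed presentations and multiplication by a pivot\<close>

lemma free_act_in: "j' = j + int i \<Longrightarrow> free_act \<pi> r d i j c \<in> free_comp r d j'"
  by (auto simp: free_comp_def free_act_def)

text \<open>A chosen finite presentation together with a window from \<open>L\<close> to
  \<open>R\<close> containing all generator and relation degrees. The window is a parameter so that
  two modules can share it.\<close>

locale presented_module = graded_module \<pi> sc M act
  for \<pi> :: "nat \<Rightarrow> 'k::comm_ring_1" and sc :: "'k \<Rightarrow> 'm::ab_group_add \<Rightarrow> 'm" and M act +
  fixes r :: nat and d :: "nat \<Rightarrow> int" and g :: "nat \<Rightarrow> 'm"
    and q :: nat and e :: "nat \<Rightarrow> int" and h :: "nat \<Rightarrow> nat \<Rightarrow> 'k" and L R :: int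
  assumes g_in: "\<forall>s<r. g s \<in> M (d s)"
    and gens: "v \<in> M j \<Longrightarrow> \<exists>c\<in>free_comp r d j. v = pres_map sc act r d g j c"
    and h_in: "t < q \<Longrightarrow> h t \<in> rel_comp sc act r d g (e t)"
    and rels: "c \<in> rel_comp sc act r d g j \<Longrightarrow> \<exists>a. \<forall>s.
      c s = (\<Sum>t\<in>{t. t < q \<and> e t \<le> j}. a t * free_act \<pi> r d (nat (j - e t)) (e t) (h t) s)"
    and d_bounds: "s < r \<Longrightarrow> L \<le> d s \<and> d s \<le> R"
    and e_bounds: "t < q \<Longrightarrow> L \<le> e t \<and> e t \<le> R"
begin

abbreviation "pres \<equiv> pres_map sc act r d g"

text \<open>Multiplication by \<open>x\<^sup>[\<^sup>N\<^sup>]\<close> induces an isomorphism from \<open>M\<^sub>j / P M\<^sub>j\<close> onto the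
  quotient of \<open>M\<^sub>j\<^sub>+\<^sub>N\<close> by \<open>carry_part N P j\<close>: surjectivity is \<open>decompose\<close>, injectivity is
  \<open>carry_part_cancel\<close>.\<close>

definition carry_part :: "nat \<Rightarrow> 'k \<Rightarrow> int \<Rightarrow> 'm set" where
  "carry_part N P j = {pres (j + int N) b | b.
     b \<in> free_comp r d (j + int N) \<and> (\<forall>s. d s \<le> j \<longrightarrow> P dvd b s)}"

lemma carry_partI: "b \<in> free_comp r d (j + int N) \<Longrightarrow> (\<And>s. s < r \<Longrightarrow> d s \<le> j \<Longrightarrow> P dvd b s)
    \<Longrightarrow> x = pres (j + int N) b \<Longrightarrow> x \<in> carry_part N P j"
  unfolding carry_part_def by (auto simp: free_comp_def) (metis dvd_0_right)

lemma carry_part_subspace: "subspace (carry_part N P j)"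
proof (rule subspaceI)
  show "0 \<in> carry_part N P j"
    by (rule carry_partI[of "\<lambda>_. 0"]) (auto simp: free_comp_def pres_map_def)
  fix x y assume "x \<in> carry_part N P j" "y \<in> carry_part N P j"
  then obtain b c where "x = pres (j + int N) b" "b \<in> free_comp r d (j + int N)" "\<forall>s. d s \<le> j \<longrightarrow> P dvd b s"
     "y = pres (j + int N) c" "c \<in> free_comp r d (j + int N)" "\<forall>s. d s \<le> j \<longrightarrow> P dvd c s"
    unfolding carry_part_def by blast
  then show "x + y \<in> carry_part N P j"
    by (intro carry_partI[of "\<lambda>s. b s + c s"]) (auto simp: free_comp_def pres_add)
next
  fix a x assume "x \<in> carry_part N P j"
  then obtain b where "x = pres (j + int N) b" "b \<in> free_comp r d (j + int N)" "\<forall>s. d s \<le> j \<longrightarrow> P dvd b s"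
    unfolding carry_part_def by blast
  then show "sc a x \<in> carry_part N P j"
    by (intro carry_partI[of "\<lambda>s. a * b s"]) (auto simp: free_comp_def pres_scale)
qed

lemma carry_part_mult:
  assumes "w \<in> M (j + int N)" shows "sc P w \<in> carry_part N P j"
proof -
  obtain c where "c \<in> free_comp r d (j + int N)" "w = pres (j + int N) c" using gens[OF assms] by blast
  then show ?thesis by (intro carry_partI[of "\<lambda>s. P * c s"]) (auto simp: free_comp_def pres_scale)
qed

text \<open>A generator of degree \<open>d s \<le> j\<close> enters \<open>y\<close> through
  \<open>x^[p + i]\<close> with \<open>p = j - d s\<close>; multiplying by \<open>x^[N - i]\<close>
  carries past \<open>N\<close> and yields a multiple of \<open>P\<close>. Generators above degree
  \<open>j\<close> are unrestricted.\<close>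

lemma carry_part_low:
  assumes "pivot \<pi> N P B" "y \<in> M j'" "j' = j + int i" "1 \<le> i" "j - L + int i < int B"
    and Lj: "L \<le> j"
  shows "act (N - i) j' y \<in> carry_part N P j"
proof -
  obtain c where c: "c \<in> free_comp r d j'" "y = pres j' c" using gens[OF assms(2)] by blast
  have BN: "B \<le> N" using assms(1) by (simp add: pivot_def)
  have iN: "i \<le> N" using assms(5) Lj BN by linarith
  have eq: "j + int N = j' + int (N - i)" using assms(3) iN by simp
  show ?thesis
  proof (rule carry_partI)
    show "act (N - i) j' y = pres (j + int N) (free_act \<pi> r d (N - i) j' c)"
      unfolding c(2) by (rule pres_act[OF g_in eq])
    show "free_act \<pi> r d (N - i) j' c \<in> free_comp r d (j + int N)" by (rule free_act_in[OF eq])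
    fix s assume s: "s < r" "d s \<le> j"
    define p where "p = nat (j - d s)"
    have p: "nat (j' - d s) = p + i" using s assms(3) by (simp add: p_def)
    have "p + i < B" using assms(5) s d_bounds[OF s(1)] unfolding p_def by linarith
    then have "P dvd Cf \<pi> (N + p) (N - i)" using assms(1,4) by (simp add: pivot_def)
    moreover have "Cf \<pi> (N + p) (N - i) = Cf \<pi> (N - i + (p + i)) (p + i)"
      using Cf_sym[of \<pi> "N - i" "p + i"] iN by (simp add: add.commute)
    ultimately show "P dvd free_act \<pi> r d (N - i) j' c s"
      unfolding free_act_def p by (auto intro: dvd_mult2)
  qed
qed

text \<open>Only generators with degree between \<open>j\<close> and \<open>j'\<close> need an
  argument: their coefficients were unrestricted before, but the product with \<open>x^[m]\<close>
  carries past \<open>N\<close> and becomes divisible by \<open>P\<close>.\<close>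

lemma carry_part_act:
  assumes "pivot \<pi> N P B" "x \<in> carry_part N P j" "m < B" "j' = j + int m"
  shows "act m (j + int N) x \<in> carry_part N P j'"
proof -
  obtain b where b: "x = pres (j + int N) b" "b \<in> free_comp r d (j + int N)" "\<forall>s. d s \<le> j \<longrightarrow> P dvd b s"
    using assms(2) unfolding carry_part_def by blast
  have BN: "B \<le> N" using assms(1) by (simp add: pivot_def)
  have eq: "j' + int N = j + int N + int m" using assms(4) by simp
  show ?thesis
  proof (rule carry_partI)
    show "act m (j + int N) x = pres (j' + int N) (free_act \<pi> r d m (j + int N) b)"
      unfolding b(1) by (rule pres_act[OF g_in eq])
    show "free_act \<pi> r d m (j + int N) b \<in> free_comp r d (j' + int N)" by (rule free_act_in[OF eq])
    fix s assume s: "s < r" "d s \<le> j'"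
    show "P dvd free_act \<pi> r d m (j + int N) b s"
    proof (cases "d s \<le> j")
      case True
      then show ?thesis using b(3) by (simp add: free_act_def)
    next
      case False
      define i where "i = nat (d s - j)"
      define p where "p = nat (j' - d s)"
      have pi: "1 \<le> i" "p + i = m" using False s(2) assms(4) by (auto simp: i_def p_def)
      have iN: "i \<le> N" using pi assms(3) BN by linarith
      have "nat (j + int N - d s) = N - i" "m + (N - i) = N + p"
        using False pi iN by (auto simp: i_def)
      moreover have "P dvd Cf \<pi> (N + p) (N - i)" using assms(1,3) pi by (simp add: pivot_def)
      ultimately show ?thesis by (simp add: free_act_def)
    qed
  qed
qed

text \<open>On generators of degree at most \<open>j\<close>, multiplication by \<open>x^[N]\<close>
  only introduces units, so these coefficients of \<open>v\<close> can be lifted exactly. All other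
  generators already belong to the carry part.\<close>

lemma decompose:
  assumes "pivot \<pi> N P B" "v \<in> M (j + int N)" "L \<le> j" "j < L + int N"
  shows "\<exists>u\<in>M j. act N j u - v \<in> carry_part N P j"
proof -
  obtain b where b: "b \<in> free_comp r d (j + int N)" "v = pres (j + int N) b" using gens[OF assms(2)] by blast
  have unit: "Cf \<pi> (N + nat (j - d s)) (nat (j - d s)) dvd 1" if s: "s < r" "d s \<le> j" for s
  proof -
    have "nat (j - d s) < N" using d_bounds[OF s(1)] s(2) assms(4) by linarith
    then have "Cf \<pi> (N + nat (j - d s)) N dvd 1" using assms(1) by (simp add: pivot_def)
    then show ?thesis using Cf_sym[of \<pi> N "nat (j - d s)"] by metis
  qed
  have "\<exists>f. \<forall>s. s < r \<and> d s \<le> j \<longrightarrow> 1 = Cf \<pi> (N + nat (j - d s)) (nat (j - d s)) * f s"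
    using unit by (intro choice) (meson dvdE)
  then obtain f where f: "\<And>s. s < r \<Longrightarrow> d s \<le> j \<Longrightarrow> 1 = Cf \<pi> (N + nat (j - d s)) (nat (j - d s)) * f s"
    by blast
  define c where "c s = f s * b s" for s
  have "act N j (pres j c) - v = pres (j + int N) (\<lambda>s. free_act \<pi> r d N j c s - b s)"
    unfolding pres_diff b(2) pres_act[OF g_in refl] by simp
  moreover have "\<dots> \<in> carry_part N P j"
  proof (rule carry_partI[OF _ _ refl])
    show "(\<lambda>s. free_act \<pi> r d N j c s - b s) \<in> free_comp r d (j + int N)"
      using b(1) free_act_in[OF refl, of \<pi> r d N j c] by (simp add: free_comp_def)
    fix s assume s: "s < r" "d s \<le> j"
    then have "free_act \<pi> r d N j c s = (Cf \<pi> (N + nat (j - d s)) (nat (j - d s)) * f s) * b s"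
      by (simp add: free_act_def c_def mult.assoc)
    then show "P dvd free_act \<pi> r d N j c s - b s" using f[OF s] by simp
  qed
  ultimately show ?thesis using pres_in[OF g_in] by metis
qed

text \<open>The hypothesis on \<open>z\<close> yields a relation in degree \<open>j + int N\<close>.
  Its components from relations of degree at most \<open>j\<close> descend to degree
  \<open>j\<close>; those from higher relations are multiples of \<open>P\<close> in the relevant
  coordinates. So the coefficients of \<open>z\<close> agree modulo \<open>P\<close> with a
  relation.\<close>

lemma carry_part_cancel:
  assumes pv: "pivot \<pi> N P B" and RB: "R - L < int B" and j: "L \<le> j" "j < L + int N"
    and z: "z \<in> M j" "act N j z \<in> carry_part N P j"
  shows "\<exists>w\<in>M j. z = sc P w"
proof -
  have BN: "B \<le> N" using pv by (simp add: pivot_def)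
  obtain c where c: "c \<in> free_comp r d j" "z = pres j c" using gens[OF z(1)] by blast
  obtain b where b: "act N j z = pres (j + int N) b" "b \<in> free_comp r d (j + int N)" "\<forall>s. d s \<le> j \<longrightarrow> P dvd b s"
    using z(2) unfolding carry_part_def by blast
  define k where "k s = free_act \<pi> r d N j c s - b s" for s
  have "k \<in> rel_comp sc act r d g (j + int N)"
    unfolding rel_comp_def
  proof (intro CollectI conjI)
    show "k \<in> free_comp r d (j + int N)" unfolding k_def
      using b(2) free_act_in[OF refl, of \<pi> r d N j c] by (simp add: free_comp_def)
    show "pres (j + int N) k = 0"
      unfolding k_def pres_diff using pres_act[OF g_in refl, of N j c] b(1) c(2) by simp
  qed
  then obtain a where a: "\<And>s. k s = (\<Sum>t\<in>{t. t < q \<and> e t \<le> j + int N}.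
      a t * free_act \<pi> r d (nat (j + int N - e t)) (e t) (h t) s)"
    using rels by blast
  have unit: "Cf \<pi> (N + nat (j - x)) N dvd 1" if x: "L \<le> x" "x \<le> j" for x
    using pv j x unfolding pivot_def by (auto simp: nat_less_iff)
  have "\<exists>om. \<forall>t. t < q \<and> e t \<le> j \<longrightarrow> 1 = Cf \<pi> (N + nat (j - e t)) N * om t"
    using unit e_bounds by (intro choice) (meson dvdE)
  then obtain om where om: "\<And>t. t < q \<Longrightarrow> e t \<le> j \<Longrightarrow> 1 = Cf \<pi> (N + nat (j - e t)) N * om t" by blast
  \<comment> \<open>The descended relation: \<open>x^[N + j - e t]\<close> is replaced by
    \<open>x^[j - e t]\<close>, and \<open>om t\<close> inverts the structure constant between
    them.\<close>
  define c0 where "c0 = (\<lambda>s. \<Sum>t\<in>{t. t < q \<and> e t \<le> j}.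
      (a t * om t) * free_act \<pi> r d (nat (j - e t)) (e t) (h t) s)"
  have "P dvd c s - c0 s" if s: "s < r" "d s \<le> j" for s
  proof -
    define eta where "eta = Cf \<pi> (N + nat (j - d s)) N"
    obtain eta' where eta': "1 = eta * eta'" using unit[of "d s"] d_bounds s unfolding eta_def by (meson dvdE)
    have k: "k s = eta * c s - b s"
      using s Cf_sym[of \<pi> N "nat (j - d s)"] by (simp add: k_def free_act_def eta_def)
    let ?F = "\<lambda>t. a t * free_act \<pi> r d (nat (j + int N - e t)) (e t) (h t) s"
    have split: "{t. t < q \<and> e t \<le> j + int N} =
        {t. t < q \<and> e t \<le> j} \<union> {t. t < q \<and> j < e t \<and> e t \<le> j + int N}" by auto
    have "k s = (\<Sum>t\<in>{t. t < q \<and> e t \<le> j}. ?F t) + (\<Sum>t\<in>{t. t < q \<and> j < e t \<and> e t \<le> j + int N}. ?F t)"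
      unfolding a split by (rule sum.union_disjoint) auto
    also have "(\<Sum>t\<in>{t. t < q \<and> e t \<le> j}. ?F t) = eta * c0 s"
      unfolding c0_def sum_distrib_left
    proof (rule sum.cong[OF refl])
      fix t assume "t \<in> {t. t < q \<and> e t \<le> j}"
      then have t: "t < q" "e t \<le> j" by auto
      show "?F t = eta * ((a t * om t) * free_act \<pi> r d (nat (j - e t)) (e t) (h t) s)"
      proof (cases "d s \<le> e t")
        case True
        define l m where "l = nat (e t - d s)" and "m = nat (j - e t)"
        have eqs: "nat (j + int N - e t) = N + m" "nat (j - d s) = m + l"
          using True t by (auto simp: l_def m_def)
        \<comment> \<open>Insert the factor \<open>Cf \<pi> (N + m) N * om t\<close>, which is 1;
          associativity then extracts the factor \<open>eta\<close>, which depends on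
          \<open>s\<close> but not on \<open>t\<close>.\<close>
        have "?F t = a t * (Cf \<pi> (N + m) N * om t) * (Cf \<pi> (N + m + l) l * h t s)"
          using True s om[OF t] by (simp add: free_act_def eqs flip: l_def m_def)
        also have "\<dots> = (a t * om t) * (Cf \<pi> (N + m) N * Cf \<pi> (N + m + l) l) * h t s"
          by (simp add: mult_ac)
        also have "\<dots> = (a t * om t) * (Cf \<pi> (m + l) l * Cf \<pi> (N + m + l) N) * h t s"
          by (subst Cf_assoc) (rule refl)
        also have "\<dots> = eta * ((a t * om t) * (Cf \<pi> (m + l) l * h t s))"
          by (simp add: eta_def eqs mult_ac add.assoc)
        also have "Cf \<pi> (m + l) l * h t s = free_act \<pi> r d (nat (j - e t)) (e t) (h t) s"
          using True s by (simp add: free_act_def flip: l_def m_def)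
        finally show ?thesis .
      qed (simp add: free_act_def)
    qed
    finally have kk: "k s = eta * c0 s + (\<Sum>t\<in>{t. t < q \<and> j < e t \<and> e t \<le> j + int N}. ?F t)" .
    have "P dvd (\<Sum>t\<in>{t. t < q \<and> j < e t \<and> e t \<le> j + int N}. ?F t)"
    proof (rule dvd_sum)
      fix t assume "t \<in> {t. t < q \<and> j < e t \<and> e t \<le> j + int N}"
      then have t: "t < q" "j < e t" "e t \<le> j + int N" by auto
      define p i where "p = nat (j - d s)" and "i = nat (e t - j)"
      have i: "1 \<le> i" "i \<le> N" "nat (j + int N - e t) = N - i" "nat (e t - d s) = p + i"
        using t s by (auto simp: i_def p_def)
      \<comment> \<open>\<open>p + i\<close> is the distance from \<open>d s\<close> to
        \<open>e t\<close>, at most the width of the window.\<close>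
      have "p + i < B" using RB e_bounds[OF t(1)] d_bounds[OF s(1)] s(2) t unfolding i_def p_def by linarith
      then have "P dvd Cf \<pi> (N + p) (N - i)" using pv i(1) by (simp add: pivot_def)
      moreover have "Cf \<pi> (N + p) (N - i) = Cf \<pi> (N - i + (p + i)) (p + i)"
        using Cf_sym[of \<pi> "N - i" "p + i"] i(2) by (simp add: add.commute)
      ultimately show "P dvd ?F t" by (simp add: free_act_def i)
    qed
    moreover have "eta * (c s - c0 s) = (\<Sum>t\<in>{t. t < q \<and> j < e t \<and> e t \<le> j + int N}. ?F t) + b s"
      using k kk by (simp add: algebra_simps)
    ultimately have "P dvd eta * (c s - c0 s)" using b(3) s(2) by simp
    \<comment> \<open>Cancel the unit \<open>eta\<close>.\<close>
    then have "P dvd eta' * (eta * (c s - c0 s))" by simp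
    also have "eta' * (eta * (c s - c0 s)) = (eta * eta') * (c s - c0 s)" by (simp only: mult_ac)
    also have "\<dots> = c s - c0 s" using eta' by simp
    finally show ?thesis .
  qed
  then have "\<exists>f. \<forall>s. s < r \<and> d s \<le> j \<longrightarrow> c s - c0 s = P * f s"
    by (intro choice) (meson dvdE)
  then obtain f where f: "\<And>s. s < r \<Longrightarrow> d s \<le> j \<Longrightarrow> c s - c0 s = P * f s" by blast
  have "z = pres j (\<lambda>s. P * f s + c0 s)"
    unfolding c(2) by (rule pres_cong) (metis f diff_add_cancel)
  moreover have "pres j c0 = 0"
    unfolding c0_def by (rule pres_relations[OF g_in]) (use h_in in \<open>auto simp: rel_comp_def\<close>)
  ultimately have "z = sc P (pres j f)" by (simp add: pres_add pres_scale)
  then show ?thesis using pres_in[OF g_in] by blast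
qed

end

section \<open>Jacobson multiples in graded modules\<close>

lemma jac_mult_left: "a \<in> (jac :: 'k::comm_ring_1 set) \<Longrightarrow> b * a \<in> jac"
  by (auto simp: jacobson_radical_def maximal_ideal_def is_ideal_def)

lemma jac_multI:
  assumes "module sc" "a \<in> jac" "s \<in> S"
  shows "sc a s \<in> jac_mult sc S"
  unfolding jac_mult_def using assms by (intro module.span_base[OF assms(1)]) blast

lemma subspace_jac_mult:
  assumes "module sc" shows "module.subspace sc (jac_mult sc S)"
  unfolding jac_mult_def by (rule module.subspace_span[OF assms])

lemma jac_mult_subset:
  assumes "module sc" "module.subspace sc T"
    and "\<And>a s. a \<in> jac \<Longrightarrow> s \<in> S \<Longrightarrow> sc a s \<in> T"
  shows "jac_mult sc S \<subseteq> T"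
  unfolding jac_mult_def by (rule module.span_minimal[OF assms(1) _ assms(2)]) (use assms(3) in blast)

context graded_module
begin

lemma jac_mult_in: "jac_mult sc (M j) \<subseteq> M j"
  by (rule jac_mult_subset[OF module_axioms sub]) (rule subspace_scale[OF sub])

lemma act_jac_mult:
  assumes "v \<in> jac_mult sc (M j)" "j' = j + int i"
  shows "act i j v \<in> jac_mult sc (M j')"
proof -
  have "jac_mult sc (M j) \<subseteq> {v \<in> M j. act i j v \<in> jac_mult sc (M j')}"
  proof (rule jac_mult_subset[OF module_axioms])
    show "subspace {v \<in> M j. act i j v \<in> jac_mult sc (M j')}"
      by (rule subspace_lin_preimage[OF module_axioms module_axioms sub act_lin
            subspace_jac_mult[OF module_axioms]])
    show "sc a s \<in> {v \<in> M j. act i j v \<in> jac_mult sc (M j')}" if "a \<in> jac" "s \<in> M j" for a s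
      using that assms(2) subspace_scale[OF sub]
      by (auto simp: act_scale intro!: jac_multI[OF module_axioms] act_in)
  qed
  then show ?thesis using assms(1) by blast
qed

lemma graded_Dmod_trunc: "graded_Dmod \<pi> sc (trunc n M) act"
proof -
  have "trunc n M j \<subseteq> M j" for j using subspace_0[OF sub] by (auto simp: trunc_def)
  moreover have "act i j v \<in> trunc n M (j + int i)" if "v \<in> trunc n M j" for i j v
    using that act_in[of v j "j + int i" i] subspace_0[OF sub]
    by (auto simp: trunc_def act_zero split: if_splits)
  moreover have "subspace (trunc n M j)" for j by (simp add: trunc_def sub)
  ultimately show ?thesis
    using gr unfolding graded_Dmod_def by (meson subsetD)
qed

end

section \<open>Graded isomorphisms and truncations\<close>

lemma gr_isomorphic_sym:
  assumes "graded_Dmod \<pi> sc M act" "gr_isomorphic sc M act sc' N act'"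
  shows "gr_isomorphic sc' N act' sc M act"
proof -
  interpret graded_module \<pi> sc M act by unfold_locales fact
  obtain f where f: "\<And>j. bij_betw (f j) (M j) (N j)"
    "\<And>j a u v. u \<in> M j \<Longrightarrow> v \<in> M j \<Longrightarrow> f j (sc a u + v) = sc' a (f j u) + f j v"
    "\<And>i j v. v \<in> M j \<Longrightarrow> f (j + int i) (act i j v) = act' i j (f j v)"
    using assms(2) unfolding gr_isomorphic_def gr_iso_def by blast
  define k where "k j = inv_into (M j) (f j)" for j
  have kf: "k j (f j v) = v" if "v \<in> M j" for j v
    using that f(1)[of j] by (simp add: k_def bij_betw_inv_into_left)
  have im: "\<exists>u\<in>M j. x = f j u" if "x \<in> N j" for x j
    using that f(1)[of j] by (auto simp: bij_betw_def)
  have "gr_iso sc' N act' sc M act k"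
    unfolding gr_iso_def
  proof (intro conjI allI ballI)
    show "bij_betw (k j) (N j) (M j)" for j
      unfolding k_def by (rule bij_betw_inv_into[OF f(1)])
    fix j a x y assume "x \<in> N j" "y \<in> N j"
    then obtain u v where uv: "u \<in> M j" "v \<in> M j" "x = f j u" "y = f j v" using im by blast
    have "sc a u + v \<in> M j" using uv subspace_add[OF sub] subspace_scale[OF sub] by blast
    then show "k j (sc' a x + y) = sc a (k j x) + k j y"
      using uv kf by (simp flip: f(2))
  next
    fix i j x assume "x \<in> N j"
    then obtain u where u: "u \<in> M j" "x = f j u" using im by blast
    then show "k (j + int i) (act' i j x) = act i j (k j x)"
      using kf act_in[OF u(1) refl, of i] by (simp flip: f(3))
  qed
  then show ?thesis unfolding gr_isomorphic_def by blast
qed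

lemma gr_isomorphic_trans:
  assumes "gr_isomorphic sc1 M1 act1 sc2 M2 act2" "gr_isomorphic sc2 M2 act2 sc3 M3 act3"
  shows "gr_isomorphic sc1 M1 act1 sc3 M3 act3"
proof -
  obtain f k where fk: "gr_iso sc1 M1 act1 sc2 M2 act2 f" "gr_iso sc2 M2 act2 sc3 M3 act3 k"
    using assms unfolding gr_isomorphic_def by blast
  then have bij: "bij_betw (f j) (M1 j) (M2 j)" "bij_betw (k j) (M2 j) (M3 j)" for j
    by (auto simp: gr_iso_def)
  have "f j v \<in> M2 j" if "v \<in> M1 j" for j v using bij(1) that by (rule bij_betw_apply)
  then have "gr_iso sc1 M1 act1 sc3 M3 act3 (\<lambda>j. k j \<circ> f j)"
    using fk bij_betw_trans[OF bij] by (simp add: gr_iso_def)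
  then show ?thesis unfolding gr_isomorphic_def by blast
qed

text \<open>Brings two truncation isomorphisms with different thresholds to a common one; in the
  newly truncated degrees only 0 remains, and it is preserved.\<close>

lemma gr_isomorphic_trunc_mono:
  assumes "graded_Dmod \<pi> sc M act" "graded_Dmod \<pi> sc' N act'" "n \<le> n'"
    and "gr_isomorphic sc (trunc n M) act sc' (trunc n N) act'"
  shows "gr_isomorphic sc (trunc n' M) act sc' (trunc n' N) act'"
proof -
  interpret m: graded_module \<pi> sc M act by unfold_locales fact
  interpret k: graded_module \<pi> sc' N act' by unfold_locales fact
  interpret mt: graded_module \<pi> sc "trunc n M" act by unfold_locales (rule m.graded_Dmod_trunc)
  obtain f where f: "gr_iso sc (trunc n M) act sc' (trunc n N) act' f"
    using assms(4) unfolding gr_isomorphic_def by blast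
  have "lin_on sc sc' (trunc n M j) (f j)" for j using f by (auto simp: gr_iso_def lin_on_def)
  then have f0: "f j 0 = 0" for j
    by (rule lin_on_zero[OF m.module_axioms k.module_axioms mt.sub])
  have sub: "trunc n' M j \<subseteq> trunc n M j" for j
    using assms(3) m.subspace_0[OF m.sub] by (auto simp: trunc_def)
  have "bij_betw (f j) (trunc n' M j) (trunc n' N j)" for j
  proof (cases "n' \<le> j")
    case True
    then have "trunc n' M j = trunc n M j" "trunc n' N j = trunc n N j"
      using assms(3) by (auto simp: trunc_def)
    then show ?thesis using f by (simp add: gr_iso_def)
  next
    case False
    then show ?thesis by (simp add: trunc_def bij_betw_def f0)
  qed
  then have "gr_iso sc (trunc n' M) act sc' (trunc n' N) act' f"
    using f sub unfolding gr_iso_def by (meson subsetD)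
  then show ?thesis unfolding gr_isomorphic_def by blast
qed

text \<open>Over the zero ring all modules vanish. This covers the case excluded in
  \<open>pivot_sequence\<close>.\<close>

lemma gr_isomorphic_trivial:
  fixes \<pi> :: "nat \<Rightarrow> 'k::comm_ring_1"
    and sc :: "'k \<Rightarrow> 'm::ab_group_add \<Rightarrow> 'm" and sc' :: "'k \<Rightarrow> 'n::ab_group_add \<Rightarrow> 'n"
  assumes "graded_Dmod \<pi> sc M act" "graded_Dmod \<pi> sc' N act'" "(1::'k) = 0"
  shows "gr_isomorphic sc M act sc' N act'"
proof -
  interpret m: graded_module \<pi> sc M act by unfold_locales fact
  interpret k: graded_module \<pi> sc' N act' by unfold_locales fact
  have zero: "v = 0" for v :: 'm using m.scale_one[of v] m.scale_zero_left[of v] assms(3) by metis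
  have zero': "v = 0" for v :: 'n using k.scale_one[of v] k.scale_zero_left[of v] assms(3) by metis
  have "M j = {0}" for j using m.subspace_0[OF m.sub[of j]] zero by blast
  moreover have "N j = {0}" for j using k.subspace_0[OF k.sub[of j]] zero' by blast
  ultimately have "gr_iso sc M act sc' N act' (\<lambda>_ _. 0)"
    unfolding gr_iso_def using zero' by (auto simp: bij_betw_def)
  then show ?thesis unfolding gr_isomorphic_def by blast
qed

section \<open>Homomorphisms out of a presented module\<close>

definition gr_hom ::
  "('k::comm_ring_1 \<Rightarrow> 'm::ab_group_add \<Rightarrow> 'm) \<Rightarrow> (int \<Rightarrow> 'm set) \<Rightarrow> (nat \<Rightarrow> int \<Rightarrow> 'm \<Rightarrow> 'm)
   \<Rightarrow> ('k \<Rightarrow> 'n::ab_group_add \<Rightarrow> 'n) \<Rightarrow> (int \<Rightarrow> 'n set) \<Rightarrow> (nat \<Rightarrow> int \<Rightarrow> 'n \<Rightarrow> 'n)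
   \<Rightarrow> (int \<Rightarrow> 'm \<Rightarrow> 'n) \<Rightarrow> bool" where
  "gr_hom sc M act sc' N act' f \<longleftrightarrow>
     (\<forall>j. lin_on sc sc' (M j) (f j)) \<and> (\<forall>j. \<forall>v\<in>M j. f j v \<in> N j) \<and>
     (\<forall>i j. \<forall>v\<in>M j. f (j + int i) (act i j v) = act' i j (f j v))"

context presented_module
begin

text \<open>The component is the image of a finite tuple space over \<open>k\<close>, with zero
  factors for generators of degree above \<open>j\<close>.\<close>

lemma acc_component:
  assumes "noetherian TYPE('k)"
  shows "acc_on sc (M j)"
proof -
  let ?S = "\<lambda>s. if d s \<le> j then UNIV else {0::'k}"
  have eq: "free_comp r d j = tuples r ?S"
  proof (intro set_eqI iffI)
    show "c \<in> tuples r ?S" if "c \<in> free_comp r d j" for c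
      using that by (auto simp: free_comp_def tuples_def)
    show "c \<in> free_comp r d j" if c: "c \<in> tuples r ?S" for c
      unfolding free_comp_def
    proof (intro CollectI allI impI)
      fix s assume "\<not> (s < r \<and> d s \<le> j)"
      moreover have "s < r \<Longrightarrow> c s \<in> ?S s" "\<not> s < r \<Longrightarrow> c s = 0" using c by (auto simp: tuples_def)
      ultimately show "c s = 0" by (cases "s < r") auto
    qed
  qed
  have S: "module.subspace (*) (?S s)" "acc_on (*) (?S s)" for s
    using acc_on_UNIV[OF assms] acc_on_zero[OF module_mult]
    by (auto simp: subspace_mult_iff is_ideal_def)
  have "acc_on sc (pres j ` free_comp r d j)"
    unfolding eq
    by (rule acc_on_image[OF module_fun_scale[OF module_mult] module_axioms
          subspace_tuples[OF module_mult S(1)] pres_lin acc_on_tuples[OF module_mult S]])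
  moreover have "pres j ` free_comp r d j = M j" using gens pres_in[OF g_in] by blast
  ultimately show ?thesis by simp
qed

text \<open>The universal property of the presentation. Values are defined through an arbitrarily
  chosen coefficient vector; two choices differ by a combination of the relations, which
  \<open>u\<close> kills.\<close>

lemma hom_of_relations:
  assumes "graded_Dmod \<pi> sc' K act'" and u: "\<forall>s<r. u s \<in> K (d s)"
    and rel0: "\<forall>t<q. pres_map sc' act' r d u (e t) (h t) = 0"
  shows "\<exists>f. gr_hom sc M act sc' K act' f \<and>
    (\<forall>j. \<forall>c\<in>free_comp r d j. f j (pres j c) = pres_map sc' act' r d u j c)"
proof -
  interpret k: graded_module \<pi> sc' K act' by unfold_locales fact
  let ?pk = "pres_map sc' act' r d u"
  define f where "f j v = ?pk j (SOME c. c \<in> free_comp r d j \<and> v = pres j c)" for j v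
  have f_pres: "f j (pres j c) = ?pk j c" if c: "c \<in> free_comp r d j" for j c
  proof -
    define b where "b = (SOME b. b \<in> free_comp r d j \<and> pres j c = pres j b)"
    have b: "b \<in> free_comp r d j \<and> pres j c = pres j b"
      unfolding b_def by (rule someI[of _ c]) (simp add: c)
    have "(\<lambda>s. b s - c s) \<in> rel_comp sc act r d g j"
      using b c by (auto simp: rel_comp_def free_comp_def pres_diff)
    then obtain a where a: "\<And>s. b s - c s =
        (\<Sum>t\<in>{t. t < q \<and> e t \<le> j}. a t * free_act \<pi> r d (nat (j - e t)) (e t) (h t) s)"
      using rels by blast
    have "?pk j b - ?pk j c = 0"
      unfolding k.pres_diff[symmetric] a
      by (rule k.pres_relations[OF u]) (use rel0 in auto)
    then show ?thesis by (simp add: f_def b_def)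
  qed
  have fc_lin: "(\<lambda>s. a * b s + c s) \<in> free_comp r d j"
    if "b \<in> free_comp r d j" "c \<in> free_comp r d j" for a b c j
    using that by (auto simp: free_comp_def)
  have "gr_hom sc M act sc' K act' f"
    unfolding gr_hom_def
  proof (intro conjI allI ballI)
    show "lin_on sc sc' (M j) (f j)" for j
      unfolding lin_on_def
    proof (intro allI ballI)
      fix a x y assume "x \<in> M j" "y \<in> M j"
      then obtain b c where bc: "b \<in> free_comp r d j" "c \<in> free_comp r d j" "x = pres j b" "y = pres j c"
        using gens by blast
      have "sc a x + y = pres j (\<lambda>s. a * b s + c s)" using bc by (simp add: pres_add pres_scale)
      then have "f j (sc a x + y) = ?pk j (\<lambda>s. a * b s + c s)"
        using f_pres[OF fc_lin[OF bc(1,2)]] by simp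
      then show "f j (sc a x + y) = sc' a (f j x) + f j y"
        using f_pres bc by (simp add: k.pres_add k.pres_scale)
    qed
    show "f j v \<in> K j" if "v \<in> M j" for j v
      unfolding f_def by (rule k.pres_in[OF u])
    show "f (j + int i) (act i j v) = act' i j (f j v)" if v: "v \<in> M j" for i j v
    proof -
      obtain c where c: "c \<in> free_comp r d j" "v = pres j c" using gens[OF v] by blast
      have "act i j v = pres (j + int i) (free_act \<pi> r d i j c)"
        unfolding c(2) by (rule pres_act[OF g_in refl])
      then show ?thesis
        using f_pres[OF c(1)] c(2) f_pres[OF free_act_in[OF refl, of \<pi> r d i j c]]
          k.pres_act[OF u refl, of i j c] by simp
    qed
  qed
  then show ?thesis using f_pres by blast
qed

end

lemma subspace_lincomb:
  assumes "module sc" "module.subspace sc T" "\<And>i. i \<in> I \<Longrightarrow> x i \<in> T"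
  shows "(\<Sum>i\<in>I. sc (c i) (x i)) \<in> T"
  by (rule module.subspace_sum[OF assms(1,2)]) (rule module.subspace_scale[OF assms(1,2)], rule assms(3))

section \<open>Recovering a finitely presented module from a truncation\<close>

text \<open>Two pivots are used. A large \<open>N\<close>, found only after Artin-Rees has fixed the
  number of factors, produces the homomorphism; the smaller \<open>N\<^sub>0\<close> brings
  surjectivity back to low degrees. The bound \<open>B\<close> exceeds \<open>N\<^sub>0\<close> plus
  the window width, so the approximation made with \<open>N\<close> reaches all degrees to which
  \<open>N\<^sub>0\<close> shifts the window.\<close>

lemma surjective_hom_of_trunc_iso:
  fixes \<pi> a :: "nat \<Rightarrow> 'k::comm_ring_1"
  assumes noeth: "noetherian TYPE('k)"
    and fpM: "presented_module \<pi> sc M act r d g q e h L R"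
    and fpK: "presented_module \<pi> sc' K act' r' d' g' q' e' h' L R"
    and LR: "L \<le> R" and n: "n \<le> R"
    and iso: "gr_iso sc (trunc n M) act sc' (trunc n K) act' \<phi>"
    and pv0: "pivot \<pi> N\<^sub>0 P\<^sub>0 B\<^sub>0" and P0: "P\<^sub>0 \<in> jac" and B0: "R - L < int B\<^sub>0"
    and a_jac: "\<And>i. a i \<in> jac" and pvs: "\<And>m. \<exists>N. pivot \<pi> N (\<Prod>i<m. a i) B"
    and B: "int N\<^sub>0 + (R - L) < int B"
  shows "\<exists>f. gr_hom sc M act sc' K act' f \<and> (\<forall>j. f j ` M j = K j)"
proof -
  interpret m: presented_module \<pi> sc M act r d g q e h L R by (rule fpM)
  interpret k: presented_module \<pi> sc' K act' r' d' g' q' e' h' L R by (rule fpK)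
  note mod = k.module_axioms
  have RB: "R - L < int B" using B by linarith
  have RN0: "R < L + int N\<^sub>0" using pv0 B0 by (simp add: pivot_def)

  have tr: "trunc n M j = M j" "trunc n K j = K j" if "n \<le> j" for j
    using that by (auto simp: trunc_def)
  have phi_bij: "\<phi> j ` M j = K j" if "n \<le> j" for j
  proof -
    have "bij_betw (\<phi> j) (trunc n M j) (trunc n K j)" using iso by (simp add: gr_iso_def)
    then show ?thesis using tr[OF that] by (simp add: bij_betw_def)
  qed
  have phi_lin: "lin_on sc sc' (M j) (\<phi> j)" if "n \<le> j" for j
  proof -
    have "lin_on sc sc' (trunc n M j) (\<phi> j)" using iso by (simp add: gr_iso_def lin_on_def)
    then show ?thesis using tr[OF that] by simp
  qed
  have phi_act: "\<phi> j' (act i j v) = act' i j (\<phi> j v)" if "n \<le> j" "v \<in> M j" "j' = j + int i" for i j j' v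
  proof -
    have "v \<in> trunc n M j" using that tr by simp
    then show ?thesis using iso that(3) by (simp add: gr_iso_def)
  qed
  have phi_in: "\<phi> j v \<in> K j" if "n \<le> j" "v \<in> M j" for j v using phi_bij that by blast

  let ?pk = "pres_map sc' act' r d"
  let ?fs = "fun_scale sc'"
  define PP where "PP = tuples r (\<lambda>s. K (d s))"
  define PJ where "PJ = tuples r (\<lambda>s. jac_mult sc' (K (d s)))"
  define QQ where "QQ = tuples q (\<lambda>t. K (e t))"
  \<comment> \<open>\<open>Lam u\<close> lists the values of the relations of \<open>M\<close> on
    candidate images \<open>u\<close> of the generators; \<open>u\<close> defines a homomorphism
    once \<open>Lam u\<close> vanishes.\<close>
  define Lam where "Lam u = (\<lambda>t. if t < q then ?pk u (e t) (h t) else 0)" for u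
  have fmod: "module ?fs" by (rule module_fun_scale[OF mod])
  have PP_sub: "module.subspace ?fs PP" unfolding PP_def by (rule subspace_tuples[OF mod k.sub])
  have PJ_sub: "module.subspace ?fs PJ" unfolding PJ_def
    by (rule subspace_tuples[OF mod subspace_jac_mult[OF mod]])
  have QQ_sub: "module.subspace ?fs QQ" unfolding QQ_def by (rule subspace_tuples[OF mod k.sub])
  have QQ_acc: "acc_on ?fs QQ" unfolding QQ_def
    by (rule acc_on_tuples[OF mod k.sub k.acc_component[OF noeth]])
  have PP_D: "\<forall>s<r. u s \<in> K (d s)" if "u \<in> PP" for u using that by (simp add: PP_def tuples_def)
  have PJ_PP: "PJ \<subseteq> PP" using k.jac_mult_in by (auto simp: PJ_def PP_def tuples_def)
  have Lam_lin: "lin_on ?fs ?fs PP Lam"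
    unfolding lin_on_def
  proof (intro allI ballI)
    fix c u v assume uv: "u \<in> PP" "v \<in> PP"
    have eq: "(\<lambda>t. sc' c (u t)) + v = (\<lambda>s. sc' c (u s) + v s)" by (simp add: fun_eq_iff)
    show "Lam ((\<lambda>t. sc' c (u t)) + v) = (\<lambda>t. sc' c (Lam u t)) + Lam v"
    proof (rule ext)
      fix t
      show "Lam ((\<lambda>t. sc' c (u t)) + v) t = ((\<lambda>t. sc' c (Lam u t)) + Lam v) t"
        unfolding eq Lam_def k.pres_lin_gens[OF PP_D[OF uv(1)] PP_D[OF uv(2)]] by simp
    qed
  qed
  have Lam_QQ: "Lam ` PP \<subseteq> QQ"
    using k.pres_in[OF PP_D] by (auto simp: QQ_def tuples_def Lam_def)
  \<comment> \<open>Artin-Rees inside \<open>QQ\<close>: a value of \<open>Lam\<close> divisible by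
    the long product is also the value of a tuple with entries in the Jacobson multiples.\<close>
  obtain m where AR: "\<And>w. w \<in> QQ \<Longrightarrow> ?fs (\<Prod>i<Suc m. a i) w \<in> Lam ` PP \<Longrightarrow> ?fs (\<Prod>i<Suc m. a i) w \<in> Lam ` PJ"
  proof (rule artin_rees[OF fmod QQ_sub QQ_acc, of "Lam ` PP" "Lam ` PJ" a])
    show "module.subspace ?fs (Lam ` PP)" by (rule subspace_lin_image[OF fmod fmod PP_sub Lam_lin])
    show "module.subspace ?fs (Lam ` PJ)"
      by (rule subspace_lin_image[OF fmod fmod PJ_sub lin_on_mono[OF Lam_lin PJ_PP]])
    show "?fs (a i) b \<in> Lam ` PJ" if b: "b \<in> Lam ` PP" for i b
    proof -
      obtain u where u: "u \<in> PP" "b = Lam u" using b by blast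
      have "?fs (a i) b = Lam (?fs (a i) u)"
        unfolding u(2) by (rule lin_on_scale[OF fmod fmod PP_sub Lam_lin u(1), symmetric])
      moreover have "?fs (a i) u \<in> PJ"
        using u(1) jac_multI[OF mod a_jac[of i]] by (auto simp: PJ_def PP_def tuples_def)
      ultimately show ?thesis by blast
    qed
  qed (use Lam_QQ PJ_PP in auto)
  define P where "P = (\<Prod>i<Suc m. a i)"
  have P_jac: "P \<in> jac" unfolding P_def using jac_mult_left[OF a_jac] by simp
  obtain N where pv: "pivot \<pi> N P B" using pvs[of "Suc m"] unfolding P_def by blast
  have BN: "B \<le> N" using pv by (simp add: pivot_def)

  \<comment> \<open>Candidate images: push each generator up by \<open>x^[N]\<close> into the range
    of \<open>\<phi>\<close>, then pull the result back modulo the carry part.\<close>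
  have "\<exists>w\<in>K (d s). act' N (d s) w - \<phi> (d s + int N) (act N (d s) (g s)) \<in> k.carry_part N P (d s)"
    if s: "s < r" for s
  proof (rule k.decompose[OF pv])
    have "n \<le> d s + int N" using m.d_bounds[OF s] RB BN n by linarith
    then show "\<phi> (d s + int N) (act N (d s) (g s)) \<in> K (d s + int N)"
      using m.g_in s by (intro phi_in m.act_in) auto
  qed (use m.d_bounds[OF s] RB BN in auto)
  then obtain u' where u': "\<And>s. s < r \<Longrightarrow> u' s \<in> K (d s) \<and>
      act' N (d s) (u' s) - \<phi> (d s + int N) (act N (d s) (g s)) \<in> k.carry_part N P (d s)" by metis
  define u where "u s = (if s < r then u' s else 0)" for s
  have u: "u \<in> PP" and uZ: "\<And>s. s < r \<Longrightarrow>
      act' N (d s) (u s) - \<phi> (d s + int N) (act N (d s) (g s)) \<in> k.carry_part N P (d s)"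
    using u' by (auto simp: u_def PP_def tuples_def)

  \<comment> \<open>The congruence on generators extends to all of degree \<open>j\<close>:
    \<open>x^[N]\<close> commutes with the coefficients, and \<open>carry_part_act\<close> controls
    the errors because \<open>j - d s < B\<close>.\<close>
  have approx: "act' N j (?pk u j c) - \<phi> (j + int N) (act N j (m.pres j c)) \<in> k.carry_part N P j"
    if j: "L \<le> j" "j < L + int B" for j c
  proof -
    let ?S = "{s. s < r \<and> d s \<le> j}"
    have nj: "n \<le> j + int N" using j RB BN n by linarith
    have term_in: "act (nat (j - d s)) (d s) (g s) \<in> M j" if "s \<in> ?S" for s
      using that by (intro m.pres_term_in[OF m.g_in]) auto
    have term_in': "act' (nat (j - d s)) (d s) (u s) \<in> K j" if "s \<in> ?S" for s
      using that by (intro k.pres_term_in[OF PP_D[OF u]]) auto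
    have 1: "act' N j (?pk u j c) = (\<Sum>s\<in>?S. sc' (c s) (act' N j (act' (nat (j - d s)) (d s) (u s))))"
      unfolding pres_map_def using term_in'
      by (subst k.act_sum) (auto simp: k.act_scale intro!: k.subspace_scale[OF k.sub])
    have "act N j (m.pres j c) = (\<Sum>s\<in>?S. sc (c s) (act N j (act (nat (j - d s)) (d s) (g s))))"
      unfolding pres_map_def using term_in
      by (subst m.act_sum) (auto simp: m.act_scale intro!: m.subspace_scale[OF m.sub])
    then have "\<phi> (j + int N) (act N j (m.pres j c)) =
        \<phi> (j + int N) (\<Sum>s\<in>?S. sc (c s) (act N j (act (nat (j - d s)) (d s) (g s))))" by (rule arg_cong)
    also have "\<dots> = (\<Sum>s\<in>?S. \<phi> (j + int N) (sc (c s) (act N j (act (nat (j - d s)) (d s) (g s)))))"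
      by (rule lin_on_sum[OF m.module_axioms mod m.sub phi_lin[OF nj]])
        (rule m.subspace_scale[OF m.sub m.act_in[OF term_in refl]])
    also have "\<dots> = (\<Sum>s\<in>?S. sc' (c s) (\<phi> (j + int N) (act N j (act (nat (j - d s)) (d s) (g s)))))"
      by (rule sum.cong[OF refl])
        (rule lin_on_scale[OF m.module_axioms mod m.sub phi_lin[OF nj] m.act_in[OF term_in refl]])
    finally have 2: "\<phi> (j + int N) (act N j (m.pres j c)) =
        (\<Sum>s\<in>?S. sc' (c s) (\<phi> (j + int N) (act N j (act (nat (j - d s)) (d s) (g s)))))" .
    have "act' N j (?pk u j c) - \<phi> (j + int N) (act N j (m.pres j c)) =
      (\<Sum>s\<in>?S. sc' (c s) (act' (nat (j - d s)) (d s + int N)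
         (act' N (d s) (u s) - \<phi> (d s + int N) (act N (d s) (g s)))))"
      unfolding 1 2 sum_subtractf[symmetric]
    proof (rule sum.cong[OF refl])
      fix s assume "s \<in> ?S"
      then have s: "s < r" "d s \<le> j" by auto
      have gs: "g s \<in> M (d s)" and us: "u s \<in> K (d s)" using s m.g_in PP_D[OF u] by auto
      have nd: "n \<le> d s + int N" using m.d_bounds[OF s(1)] RB BN n by linarith
      let ?i = "nat (j - d s)"
      have "act' N j (act' ?i (d s) (u s)) = act' ?i (d s + int N) (act' N (d s) (u s))"
        by (rule k.act_comm[OF us]) (use s in auto)
      moreover have "act N j (act ?i (d s) (g s)) = act ?i (d s + int N) (act N (d s) (g s))"
        by (rule m.act_comm[OF gs]) (use s in auto)
      moreover have "\<phi> (j + int N) (act ?i (d s + int N) (act N (d s) (g s)))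
          = act' ?i (d s + int N) (\<phi> (d s + int N) (act N (d s) (g s)))"
        by (rule phi_act[OF nd m.act_in[OF gs refl]]) (use s in auto)
      ultimately show "sc' (c s) (act' N j (act' ?i (d s) (u s))) -
          sc' (c s) (\<phi> (j + int N) (act N j (act ?i (d s) (g s)))) =
         sc' (c s) (act' ?i (d s + int N) (act' N (d s) (u s) - \<phi> (d s + int N) (act N (d s) (g s))))"
        using k.act_diff[OF k.act_in[OF us refl, of N] phi_in[OF nd m.act_in[OF gs refl, of N]], of ?i]
        by (simp add: k.scale_right_diff_distrib)
    qed
    also have "\<dots> \<in> k.carry_part N P j"
    proof (rule subspace_lincomb[OF mod k.carry_part_subspace])
      fix s assume "s \<in> ?S"
      then have s: "s < r" "d s \<le> j" by auto
      show "act' (nat (j - d s)) (d s + int N)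
         (act' N (d s) (u s) - \<phi> (d s + int N) (act N (d s) (g s))) \<in> k.carry_part N P j"
        by (rule k.carry_part_act[OF pv uZ[OF s(1)]]) (use s m.d_bounds[OF s(1)] j in auto)
    qed
    finally show ?thesis .
  qed

  \<comment> \<open>For a relation of \<open>M\<close> the \<open>\<phi>\<close> term in
    \<open>approx\<close> is 0, so cancelling \<open>x^[N]\<close> shows that its value on
    \<open>u\<close> is a multiple of \<open>P\<close>.\<close>
  have "\<exists>w\<in>K (e t). ?pk u (e t) (h t) = sc' P w" if t: "t < q" for t
  proof (rule k.carry_part_cancel[OF pv RB _ _ k.pres_in[OF PP_D[OF u]]])
    have et: "L \<le> e t" "e t < L + int B" using m.e_bounds[OF t] RB by auto
    have nt: "n \<le> e t + int N" using et RB BN n by linarith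
    have "m.pres (e t) (h t) = 0" using m.h_in[OF t] by (simp add: rel_comp_def)
    then show "act' N (e t) (?pk u (e t) (h t)) \<in> k.carry_part N P (e t)"
      using approx[OF et, of "h t"] lin_on_zero[OF m.module_axioms mod m.sub phi_lin[OF nt]]
      by (simp add: m.act_zero)
  qed (use m.e_bounds[OF t] RB BN in auto)
  then obtain w' where w': "\<And>t. t < q \<Longrightarrow> w' t \<in> K (e t) \<and> ?pk u (e t) (h t) = sc' P (w' t)" by metis
  define w where "w t = (if t < q then w' t else 0)" for t
  have "w \<in> QQ" using w' by (auto simp: QQ_def tuples_def w_def)
  moreover have "Lam u = ?fs P w" using w' by (auto simp: Lam_def w_def fun_eq_iff)
  ultimately have "Lam u \<in> Lam ` PJ" using AR[of w] u unfolding P_def[symmetric] by (metis imageI)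
  then obtain z where z: "z \<in> PJ" "Lam u = Lam z" by blast
  have zPP: "z \<in> PP" using z PJ_PP by blast
  \<comment> \<open>Subtract the correction \<open>z\<close>, which has the same relation values and
    is 0 modulo the Jacobson radical; the scalar -1 fits \<open>pres_lin_gens\<close>.\<close>
  define u0 where "u0 = (\<lambda>s. sc' (-1) (z s) + u s)"
  have u0: "\<forall>s<r. u0 s \<in> K (d s)"
    using PP_D[OF zPP] PP_D[OF u] 
    by (simp add: u0_def k.subspace_diff[OF k.sub])
  have pk_u0: "?pk u0 j c = ?pk u j c - ?pk z j c" for j c
    using k.pres_lin_gens[OF PP_D[OF zPP] PP_D[OF u], of "-1" j c] by (simp add: u0_def)
  have rel0: "\<forall>t<q. ?pk u0 (e t) (h t) = 0"
  proof (intro allI impI)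
    fix t assume "t < q"
    then show "?pk u0 (e t) (h t) = 0" using z(2) unfolding pk_u0 by (metis Lam_def right_minus_eq)
  qed
  obtain f where f: "gr_hom sc M act sc' K act' f"
    and f_pres: "\<forall>j. \<forall>c\<in>free_comp r d j. f j (m.pres j c) = ?pk u0 j c"
    using m.hom_of_relations[OF k.gr u0 rel0] by blast
  have f_lin: "lin_on sc sc' (M j) (f j)" for j using f by (simp add: gr_hom_def)
  have f_in: "f j v \<in> K j" if "v \<in> M j" for j v using f that by (simp add: gr_hom_def)
  have f_act: "f (j + int i) (act i j v) = act' i j (f j v)" if "v \<in> M j" for i j v
    using f that by (simp add: gr_hom_def)

  have z_jac: "?pk z j c \<in> jac_mult sc' (K j)" for j c
    unfolding pres_map_def
  proof (rule subspace_lincomb[OF mod subspace_jac_mult[OF mod]])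
    fix s assume "s \<in> {s. s < r \<and> d s \<le> j}"
    then show "act' (nat (j - d s)) (d s) (z s) \<in> jac_mult sc' (K j)"
      using z(1) by (intro k.act_jac_mult) (auto simp: PJ_def tuples_def)
  qed
  have im_sub: "k.subspace (f j ` M j)" for j
    by (rule subspace_lin_image[OF m.module_axioms mod m.sub f_lin])
  have onto_by_nakayama: "f j ` M j = K j"
    if "\<And>x. x \<in> K j \<Longrightarrow> \<exists>v\<in>M j. x - f j v \<in> jac_mult sc' (K j)" for j
    by (rule nakayama[OF mod k.sub k.acc_component[OF noeth] im_sub]) (use f_in that in auto)

  \<comment> \<open>Here \<open>\<phi>\<close> is defined and onto, and \<open>f\<close> agrees with
    it modulo the Jacobson radical: one error is a multiple of \<open>P\<close> by cancellation of
    \<open>x^[N]\<close>, the other comes from \<open>z\<close>.\<close>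
  have high: "f j ` M j = K j" if j: "R \<le> j" "j < L + int B" for j
  proof (rule onto_by_nakayama)
    fix x assume x: "x \<in> K j"
    have nj: "n \<le> j" using j n by linarith
    have Lj: "L \<le> j" "j < L + int N" using j BN LR by linarith+
    obtain v where v: "v \<in> M j" "x = \<phi> j v" using phi_bij[OF nj] x by blast
    obtain c where c: "c \<in> free_comp r d j" "v = m.pres j c" using m.gens[OF v(1)] by blast
    have "\<phi> (j + int N) (act N j v) = act' N j x" unfolding v(2) by (rule phi_act[OF nj v(1) refl])
    then have "act' N j (?pk u j c - x) \<in> k.carry_part N P j"
      using approx[OF Lj(1) j(2), of c] c(2) k.act_diff[OF k.pres_in[OF PP_D[OF u]] x] by simp
    then obtain y where y: "y \<in> K j" "?pk u j c - x = sc' P y"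
      using k.carry_part_cancel[OF pv RB Lj] k.subspace_diff[OF k.sub k.pres_in[OF PP_D[OF u]] x] by blast
    have "x - f j v = ?pk z j c - sc' P y"
      using f_pres[rule_format, OF c(1)] c(2) y(2) pk_u0[of j c] by (simp add: algebra_simps)
    also have "\<dots> \<in> jac_mult sc' (K j)"
      by (rule k.subspace_diff[OF subspace_jac_mult[OF mod] z_jac jac_multI[OF mod P_jac y(1)]])
    finally show "\<exists>v\<in>M j. x - f j v \<in> jac_mult sc' (K j)" using v(1) by blast
  qed

  \<comment> \<open>Generator images need not be generators of \<open>K\<close>, so each term is
    checked: coefficients divisible by \<open>P\<^sub>0\<close> give multiples of
    \<open>P\<^sub>0\<close>, and generators of degree above \<open>j\<close> fall under
    \<open>carry_part_low\<close>.\<close>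
  have f_carry_part: "f (j + int N\<^sub>0) x \<in> k.carry_part N\<^sub>0 P\<^sub>0 j" if x: "x \<in> m.carry_part N\<^sub>0 P\<^sub>0 j" and j: "L \<le> j" for x j
  proof -
    obtain b :: "nat \<Rightarrow> 'k" where b: "x = m.pres (j + int N\<^sub>0) b" "b \<in> free_comp r d (j + int N\<^sub>0)"
      "\<forall>s. d s \<le> j \<longrightarrow> P\<^sub>0 dvd b s"
      using x unfolding m.carry_part_def by blast
    have "f (j + int N\<^sub>0) x = ?pk u0 (j + int N\<^sub>0) b" unfolding b(1) by (rule f_pres[rule_format, OF b(2)])
    also have "\<dots> \<in> k.carry_part N\<^sub>0 P\<^sub>0 j" unfolding pres_map_def
    proof (rule k.subspace_sum[OF k.carry_part_subspace])
      fix s assume "s \<in> {s. s < r \<and> d s \<le> j + int N\<^sub>0}"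
      then have s: "s < r" "d s \<le> j + int N\<^sub>0" by auto
      let ?y = "act' (nat (j + int N\<^sub>0 - d s)) (d s) (u0 s)"
      have y: "?y \<in> K (j + int N\<^sub>0)" by (rule k.pres_term_in[OF u0 s])
      show "sc' (b s) ?y \<in> k.carry_part N\<^sub>0 P\<^sub>0 j"
      proof (cases "d s \<le> j")
        case True
        then obtain b' where "b s = P\<^sub>0 * b'" using b(3) by (meson dvdE)
        then have "sc' (b s) ?y = sc' P\<^sub>0 (sc' b' ?y)" by simp
        then show ?thesis using k.carry_part_mult[OF k.subspace_scale[OF k.sub y]] by simp
      next
        case False
        define i where "i = nat (d s - j)"
        have i: "1 \<le> i" "d s = j + int i" "nat (j + int N\<^sub>0 - d s) = N\<^sub>0 - i"
          using False by (auto simp: i_def)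
        have "act' (N\<^sub>0 - i) (d s) (u0 s) \<in> k.carry_part N\<^sub>0 P\<^sub>0 j"
          by (rule k.carry_part_low[OF pv0 _ i(2) i(1) _ j]) (use u0 s m.d_bounds[OF s(1)] B0 i in auto)
        then show ?thesis unfolding i(3) by (rule k.subspace_scale[OF k.carry_part_subspace])
      qed
    qed
    finally show ?thesis .
  qed

  \<comment> \<open>Shift \<open>x\<close> by \<open>N\<^sub>0\<close> into the range of
    \<open>high\<close>, lift it to \<open>y\<close>, write \<open>y\<close> as
    \<open>x^[N\<^sub>0]\<close> times \<open>v\<close> modulo the carry part, and cancel;
    \<open>f j v\<close> then equals \<open>x\<close> modulo \<open>P\<^sub>0\<close>.\<close>
  have low: "f j ` M j = K j" if j: "L \<le> j" "j \<le> R" for j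
  proof (rule onto_by_nakayama)
    fix x assume x: "x \<in> K j"
    have jN: "R \<le> j + int N\<^sub>0" "j + int N\<^sub>0 < L + int B" "j < L + int N\<^sub>0"
      using j RN0 B by linarith+
    have x': "act' N\<^sub>0 j x \<in> K (j + int N\<^sub>0)" by (rule k.act_in[OF x refl])
    then obtain y where y: "y \<in> M (j + int N\<^sub>0)" "act' N\<^sub>0 j x = f (j + int N\<^sub>0) y"
      using high[OF jN(1,2)] by (metis imageE)
    obtain v where v: "v \<in> M j" "act N\<^sub>0 j v - y \<in> m.carry_part N\<^sub>0 P\<^sub>0 j"
      using m.decompose[OF pv0 y(1) j(1) jN(3)] by blast
    have "act' N\<^sub>0 j (f j v - x) = f (j + int N\<^sub>0) (act N\<^sub>0 j v - y)"
      using k.act_diff[OF f_in[OF v(1)] x] f_act[OF v(1)] y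
        lin_on_diff[OF m.module_axioms mod m.sub f_lin m.act_in[OF v(1) refl] y(1)] by simp
    then have "act' N\<^sub>0 j (f j v - x) \<in> k.carry_part N\<^sub>0 P\<^sub>0 j" using f_carry_part[OF v(2) j(1)] by simp
    then obtain t where t: "t \<in> K j" "f j v - x = sc' P\<^sub>0 t"
      using k.carry_part_cancel[OF pv0 B0 j(1) jN(3)] k.subspace_diff[OF k.sub f_in[OF v(1)] x] by blast
    have "f j v - x \<in> jac_mult sc' (K j)" unfolding t(2) by (rule jac_multI[OF mod P0 t(1)])
    then have "- (f j v - x) \<in> jac_mult sc' (K j)" by (rule k.subspace_neg[OF subspace_jac_mult[OF mod]])
    then show "\<exists>v\<in>M j. x - f j v \<in> jac_mult sc' (K j)" using v(1) by auto
  qed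

  \<comment> \<open>All generators of \<open>K\<close> have degrees in the window, so they are hit
    by \<open>low\<close>, and they generate the rest.\<close>
  have "f j ` M j = K j" for j
  proof
    show "f j ` M j \<subseteq> K j" using f_in by blast
    show "K j \<subseteq> f j ` M j"
    proof
      fix x assume "x \<in> K j"
      then obtain c where c: "x = k.pres j c" using k.gens by blast
      show "x \<in> f j ` M j" unfolding c pres_map_def
      proof (rule subspace_lincomb[OF mod im_sub])
        fix s assume "s \<in> {s. s < r' \<and> d' s \<le> j}"
        then have s: "s < r'" "d' s \<le> j" by auto
        obtain y where y: "y \<in> M (d' s)" "g' s = f (d' s) y"
          using low[of "d' s"] k.d_bounds[OF s(1)] k.g_in s(1) by (metis imageE)
        have "act' (nat (j - d' s)) (d' s) (g' s) = f j (act (nat (j - d' s)) (d' s) y)"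
          using f_act[OF y(1), of "nat (j - d' s)"] s(2) y(2) by simp
        moreover have "act (nat (j - d' s)) (d' s) y \<in> M j" by (rule m.act_in[OF y(1)]) (use s in simp)
        ultimately show "act' (nat (j - d' s)) (d' s) (g' s) \<in> f j ` M j" by blast
      qed
    qed
  qed
  then show ?thesis using f by blast
qed

text \<open>All wider windows are allowed, so that two modules can later be given the same
  one.\<close>

lemma fin_pres_presented_module:
  assumes "fin_pres \<pi> sc M act"
  shows "\<exists>r d g q e h L\<^sub>0 R\<^sub>0. \<forall>L R. L \<le> L\<^sub>0 \<longrightarrow> R\<^sub>0 \<le> R \<longrightarrow> presented_module \<pi> sc M act r d g q e h L R"
proof -
  have gr: "graded_Dmod \<pi> sc M act" using assms by (simp add: fin_pres_def)
  obtain r d g where gens: "gr_generated_by sc M act r d g" and fg: "rel_fin_gen \<pi> sc act r d g"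
    using assms unfolding fin_pres_def by blast
  from fg obtain q :: nat and e h where h: "\<forall>t<q. h t \<in> rel_comp sc act r d g (e t)"
    and rels: "\<forall>j. \<forall>c\<in>rel_comp sc act r d g j. \<exists>a. \<forall>s.
      c s = (\<Sum>t\<in>{t. t < q \<and> e t \<le> j}. a t * free_act \<pi> r d (nat (j - e t)) (e t) (h t) s)"
    unfolding rel_fin_gen_def by blast
  define D where "D = d ` {..<r} \<union> e ` {..<q}"
  have D: "finite D" by (simp add: D_def)
  \<comment> \<open>Inserting 0 keeps \<open>Min\<close> and \<open>Max\<close> meaningful when
    there are no generators or relations.\<close>
  have "presented_module \<pi> sc M act r d g q e h L R" if LR: "L \<le> Min (insert 0 D)" "Max (insert 0 D) \<le> R" for L R
  proof -
    have bd: "L \<le> x \<and> x \<le> R" if "x \<in> D" for x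
      using that LR D Min_le[of "insert 0 D" x] Max_ge[of "insert 0 D" x] by auto
    show ?thesis
    proof unfold_locales
      show "graded_Dmod \<pi> sc M act" by (rule gr)
      show "\<forall>s<r. g s \<in> M (d s)" using gens by (simp add: gr_generated_by_def)
      show "\<exists>c\<in>free_comp r d j. v = pres_map sc act r d g j c" if "v \<in> M j" for v j
        using gens that by (simp add: gr_generated_by_def)
      show "h t \<in> rel_comp sc act r d g (e t)" if "t < q" for t using h that by simp
      show "\<exists>a. \<forall>s. c s = (\<Sum>t\<in>{t. t < q \<and> e t \<le> j}. a t * free_act \<pi> r d (nat (j - e t)) (e t) (h t) s)"
        if "c \<in> rel_comp sc act r d g j" for c j using rels that by blast
      show "L \<le> d s \<and> d s \<le> R" if "s < r" for s using bd that by (simp add: D_def)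
      show "L \<le> e t \<and> e t \<le> R" if "t < q" for t using bd that by (simp add: D_def)
    qed
  qed
  then show ?thesis by blast
qed

text \<open>Surjections in both directions compose to a surjective endomorphism of each noetherian
  component of \<open>M\<close>, which is injective; hence so is the first map.\<close>

lemma fin_pres_determined_by_trunc:
  fixes \<pi> :: "nat \<Rightarrow> 'k::comm_ring_1"
  assumes noeth: "noetherian TYPE('k)" and adm: "admissible \<pi>"
    and inf: "infinite {n. \<pi> n \<in> (jac :: 'k set)}"
    and fpM: "fin_pres \<pi> sc M act" and fpK: "fin_pres \<pi> sc' K act'"
    and iso: "gr_isomorphic sc (trunc n M) act sc' (trunc n K) act'"
  shows "gr_isomorphic sc M act sc' K act'"
proof (cases "(1::'k) = 0")
  case True
  show ?thesis
    by (rule gr_isomorphic_trivial[OF _ _ True]) (use fpM fpK in \<open>auto simp: fin_pres_def\<close>)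
next
  case False
  obtain r d g q e h L\<^sub>1 R\<^sub>1
    where M: "\<forall>L R. L \<le> L\<^sub>1 \<longrightarrow> R\<^sub>1 \<le> R \<longrightarrow> presented_module \<pi> sc M act r d g q e h L R"
    using fin_pres_presented_module[OF fpM] by blast
  obtain r' d' g' q' e' h' L\<^sub>2 R\<^sub>2
    where K: "\<forall>L R. L \<le> L\<^sub>2 \<longrightarrow> R\<^sub>2 \<le> R \<longrightarrow> presented_module \<pi> sc' K act' r' d' g' q' e' h' L R"
    using fin_pres_presented_module[OF fpK] by blast
  define L R where "L = min n (min L\<^sub>1 L\<^sub>2)" and "R = max n (max R\<^sub>1 R\<^sub>2)"
  have fM: "presented_module \<pi> sc M act r d g q e h L R" by (rule M[rule_format]) (auto simp: L_def R_def)
  have fK: "presented_module \<pi> sc' K act' r' d' g' q' e' h' L R" by (rule K[rule_format]) (auto simp: L_def R_def)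
  interpret m: presented_module \<pi> sc M act r d g q e h L R by (rule fM)
  interpret k: presented_module \<pi> sc' K act' r' d' g' q' e' h' L R by (rule fK)
  have nR: "n \<le> R" and LR: "L \<le> R" by (auto simp: L_def R_def)
  note pivots = pivot_sequence[OF noeth adm inf False]
  obtain b :: "nat \<Rightarrow> 'k" where b: "\<forall>i. b i \<in> jac" "\<forall>l. \<exists>N. pivot \<pi> N (\<Prod>i<l. b i) (nat (R - L) + 1)"
    using pivots[of "nat (R - L) + 1"] by blast
  \<comment> \<open>A single factor suffices for the small pivot, since it only has to lie in the
    Jacobson radical.\<close>
  obtain N\<^sub>0 where "pivot \<pi> N\<^sub>0 (\<Prod>i<1. b i) (nat (R - L) + 1)" using b(2) by blast
  then have pv0: "pivot \<pi> N\<^sub>0 (b 0) (nat (R - L) + 1)" by simp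
  \<comment> \<open>The second sequence is chosen after \<open>N\<^sub>0\<close>, because its bound
    must exceed it. Pivots depend only on \<open>\<pi>\<close>, so the same choices serve both
    directions.\<close>
  obtain a :: "nat \<Rightarrow> 'k" where a: "\<forall>i. a i \<in> jac" "\<forall>l. \<exists>N. pivot \<pi> N (\<Prod>i<l. a i) (N\<^sub>0 + nat (R - L) + 1)"
    using pivots[of "N\<^sub>0 + nat (R - L) + 1"] by blast
  obtain \<phi> where phi: "gr_iso sc (trunc n M) act sc' (trunc n K) act' \<phi>"
    using iso unfolding gr_isomorphic_def by blast
  obtain \<psi> where psi: "gr_iso sc' (trunc n K) act' sc (trunc n M) act \<psi>"
    using gr_isomorphic_sym[OF m.graded_Dmod_trunc iso] unfolding gr_isomorphic_def by blast
  have bd: "R - L < int (nat (R - L) + 1)"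
    "int N\<^sub>0 + (R - L) < int (N\<^sub>0 + nat (R - L) + 1)" by auto
  obtain f where f: "gr_hom sc M act sc' K act' f" "\<forall>j. f j ` M j = K j"
    using surjective_hom_of_trunc_iso[OF noeth fM fK LR nR phi pv0 b(1)[rule_format] bd(1)
        a[rule_format] bd(2)] by blast
  obtain f' where f': "gr_hom sc' K act' sc M act f'" "\<forall>j. f' j ` K j = M j"
    using surjective_hom_of_trunc_iso[OF noeth fK fM LR nR psi pv0 b(1)[rule_format] bd(1)
        a[rule_format] bd(2)] by blast
  have "bij_betw (f j) (M j) (K j)" for j
  proof -
    have "lin_on sc sc (M j) (f' j \<circ> f j)"
      using f(1) f'(1) by (simp add: gr_hom_def lin_on_def)
    moreover have "(f' j \<circ> f j) ` M j = M j" using f(2) f'(2) by (metis image_comp)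
    ultimately have "inj_on (f' j \<circ> f j) (M j)"
      by (rule inj_on_surj_endo[OF m.module_axioms m.sub m.acc_component[OF noeth]])
    then show ?thesis unfolding bij_betw_def using f(2) inj_on_imageI2[of "f' j" "f j"] by blast
  qed
  then have "gr_iso sc M act sc' K act' f"
    unfolding gr_iso_def using f(1) by (simp add: gr_hom_def lin_on_def)
  then show ?thesis unfolding gr_isomorphic_def by blast
qed

text \<open>Above the larger of the two thresholds both envelopes agree with \<open>M\<close>, hence
  with each other.\<close>

lemma weak_fp_envelope_unique:
  fixes \<pi> :: "nat \<Rightarrow> 'k::comm_ring_1"
  assumes noeth: "noetherian TYPE('k)" and adm: "admissible \<pi>"
    and inf: "infinite {n. \<pi> n \<in> (jac :: 'k set)}"
    and e1: "weak_fp_envelope \<pi> sc M act sc1 N1 act1"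
    and e2: "weak_fp_envelope \<pi> sc M act sc2 N2 act2"
  shows "gr_isomorphic sc1 N1 act1 sc2 N2 act2"
proof -
  obtain n1 n2 where M: "graded_Dmod \<pi> sc M act"
    and N1: "fin_pres \<pi> sc1 N1 act1" and N2: "fin_pres \<pi> sc2 N2 act2"
    and i1: "gr_isomorphic sc (trunc n1 M) act sc1 (trunc n1 N1) act1"
    and i2: "gr_isomorphic sc (trunc n2 M) act sc2 (trunc n2 N2) act2"
    using e1 e2 unfolding weak_fp_envelope_def nfp_conditions_def by blast
  interpret graded_module \<pi> sc M act by unfold_locales (rule M)
  let ?n = "max n1 n2"
  have j1: "gr_isomorphic sc (trunc ?n M) act sc1 (trunc ?n N1) act1"
    by (rule gr_isomorphic_trunc_mono[OF M _ _ i1]) (use N1 in \<open>auto simp: fin_pres_def\<close>)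
  have j2: "gr_isomorphic sc (trunc ?n M) act sc2 (trunc ?n N2) act2"
    by (rule gr_isomorphic_trunc_mono[OF M _ _ i2]) (use N2 in \<open>auto simp: fin_pres_def\<close>)
  have "gr_isomorphic sc1 (trunc ?n N1) act1 sc2 (trunc ?n N2) act2"
    by (rule gr_isomorphic_trans[OF gr_isomorphic_sym[OF graded_Dmod_trunc j1] j2])
  then show ?thesis by (rule fin_pres_determined_by_trunc[OF noeth adm inf N1 N2])
qed

theorem theorem9p12:
  fixes \<pi> :: "nat \<Rightarrow> 'k::comm_ring_1"
  assumes "noetherian TYPE('k)"
    and "pi_sequence \<pi>" and "admissible \<pi>"
    and "infinite {n. \<pi> n \<in> jacobson_radical TYPE('k)}"
  shows "(\<forall>(sc :: 'k \<Rightarrow> 'm::ab_group_add \<Rightarrow> 'm) M act (sc' :: 'k \<Rightarrow> 'n::ab_group_add \<Rightarrow> 'n) N act' n.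
            fin_pres \<pi> sc M act \<and> fin_pres \<pi> sc' N act' \<and>
            gr_isomorphic sc (trunc n M) act sc' (trunc n N) act'
            \<longrightarrow> gr_isomorphic sc M act sc' N act')
       \<and> (\<forall>(sc :: 'k \<Rightarrow> 'a::ab_group_add \<Rightarrow> 'a) M act
            (sc1 :: 'k \<Rightarrow> 'b::ab_group_add \<Rightarrow> 'b) N1 act1
            (sc2 :: 'k \<Rightarrow> 'c::ab_group_add \<Rightarrow> 'c) N2 act2.
            weak_fp_envelope \<pi> sc M act sc1 N1 act1 \<and> weak_fp_envelope \<pi> sc M act sc2 N2 act2
            \<longrightarrow> gr_isomorphic sc1 N1 act1 sc2 N2 act2)"
  using fin_pres_determined_by_trunc[OF assms(1,3,4)] weak_fp_envelope_unique[OF assms(1,3,4)]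
  by blast

end
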